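(* Let $R$ be a commutative Noetherian ring and let $M$ be a finitely generated, faithful and reflexive $R$-module. Then the map $\sigma : \operatorname{End}_R(\tau_M(R)) \to \operatorname{End}_R(M)$ defined in the context takes values in the center $Z(\operatorname{End}_R(M))$, and $$\sigma : \operatorname{End}_R(\tau_M(R)) \longrightarrow Z(\operatorname{End}_R(M))$$ is an isomorphism of $R$-algebras.
   Context: For an $R$-module $M$ put $M^* = \operatorname{Hom}_R(M,R)$. The trace ideal of $M$ is $\tau_M(R) = \sum_{\alpha\in M^*}\alpha(M)\subseteq R$; it is the image of the trace map $\vartheta_M : M\otimes_R M^*\to R$, $m\otimes\alpha\mapsto\alpha(m)$. $M$ is reflexive if the evaluation map $\varepsilon_M: M\to M^{**}$, $m\mapsto(\psi\mapsto\psi(m))$, is an isomorphism. $Z(S)$ denotes the center of a ring $S$. Definition of $\sigma$ (for $M$ reflexive). Every $R$-homomorphism $\tau_M(R)\to R$ has image in $\tau_M(R)$, so $\operatorname{End}_R(\tau_M(R)) = \operatorname{Hom}_R(\tau_M(R),R)$. As $M$ is reflexive, Hom-tensor adjointness gives an isomorphism $\vartheta:\operatorname{End}_R(M)\to\operatorname{Hom}_R(M\otimes_R M^*,R)$, $\vartheta(f)(m\otimes\alpha)=\alpha(f(m))$. Precomposition with the surjection $\vartheta_M: M\otimes_R M^*\to\tau_M(R)$ gives an injection $\vartheta_M^*:\operatorname{Hom}_R(\tau_M(R),R)\to\operatorname{Hom}_R(M\otimes_R M^*,R)$. Define $\sigma=\vartheta^{-1}\circ\vartheta_M^*:\operatorname{End}_R(\tau_M(R))\to\operatorname{End}_R(M)$.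 *)

theory Defs
  imports "HOL-Algebra.Module" "HOL-Algebra.Ring_Divisibility"
begin

text \<open>
  All maps between modules are extensional, i.e. \<open>undefined\<close> outside the carrier of their domain,
  so that equality of maps is equality on the carrier. The type of modules extends that of rings;
  for modules without a multiplication the fields \<open>mult\<close> and \<open>one\<close> are left unspecified.
\<close>

section \<open>Modules of homomorphisms\<close>

definition lin_maps ::
    "('a, 'k) ring_scheme \<Rightarrow> ('a, 'b, 'm) module_scheme \<Rightarrow> ('a, 'c, 'n) module_scheme \<Rightarrow> ('b \<Rightarrow> 'c) set"
  where "lin_maps R M N = {f \<in> carrier M \<rightarrow>\<^sub>E carrier N.
    (\<forall>x \<in> carrier M. \<forall>y \<in> carrier M. f (x \<oplus>\<^bsub>M\<^esub> y) = f x \<oplus>\<^bsub>N\<^esub> f y) \<and>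
    (\<forall>r \<in> carrier R. \<forall>x \<in> carrier M. f (r \<odot>\<^bsub>M\<^esub> x) = r \<odot>\<^bsub>N\<^esub> f x)}"

definition Hom_mod ::
    "('a, 'k) ring_scheme \<Rightarrow> ('a, 'b, 'm) module_scheme \<Rightarrow> ('a, 'c, 'n) module_scheme \<Rightarrow> ('a, 'b \<Rightarrow> 'c) module"
  where "Hom_mod R M N =
    \<lparr>carrier = lin_maps R M N, monoid.mult = undefined, one = undefined,
     ring.zero = (\<lambda>x\<in>carrier M. \<zero>\<^bsub>N\<^esub>),
     ring.add = (\<lambda>f g. \<lambda>x\<in>carrier M. f x \<oplus>\<^bsub>N\<^esub> g x),
     smult = (\<lambda>r f. \<lambda>x\<in>carrier M. r \<odot>\<^bsub>N\<^esub> f x)\<rparr>"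

definition End_alg ::
    "('a, 'k) ring_scheme \<Rightarrow> ('a, 'b, 'm) module_scheme \<Rightarrow> ('a, 'b \<Rightarrow> 'b) module"
  where "End_alg R M = (Hom_mod R M M)
    \<lparr>monoid.mult := (\<lambda>f g. compose (carrier M) f g), one := (\<lambda>x\<in>carrier M. x)\<rparr>"

definition mod_iso ::
    "('a, 'k) ring_scheme \<Rightarrow> ('a, 'b, 'm) module_scheme \<Rightarrow> ('a, 'c, 'n) module_scheme \<Rightarrow> ('b \<Rightarrow> 'c) set"
  where "mod_iso R M N = {f \<in> lin_maps R M N. bij_betw f (carrier M) (carrier N)}"

definition alg_iso ::
    "('a, 'k) ring_scheme \<Rightarrow> ('a, 'b, 'm) module_scheme \<Rightarrow> ('a, 'c, 'n) module_scheme \<Rightarrow> ('b \<Rightarrow> 'c) set"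
  where "alg_iso R A B = {f \<in> ring_iso A B.
    \<forall>r \<in> carrier R. \<forall>x \<in> carrier A. f (r \<odot>\<^bsub>A\<^esub> x) = r \<odot>\<^bsub>B\<^esub> f x}"

definition center_alg :: "('a, 'b, 'm) module_scheme \<Rightarrow> ('a, 'b, 'm) module_scheme"
  where "center_alg A =
    A\<lparr>carrier := {z \<in> carrier A. \<forall>a \<in> carrier A. z \<otimes>\<^bsub>A\<^esub> a = a \<otimes>\<^bsub>A\<^esub> z}\<rparr>"


section \<open>Duals, reflexivity, generation, faithfulness\<close>

definition regular_mod :: "('a, 'k) ring_scheme \<Rightarrow> ('a, 'a) module"
  where "regular_mod R =
    \<lparr>carrier = carrier R, monoid.mult = monoid.mult R, one = one R, ring.zero = ring.zero R, ring.add = ring.add R, smult = monoid.mult R\<rparr>"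

definition dual_mod :: "('a, 'k) ring_scheme \<Rightarrow> ('a, 'b, 'm) module_scheme \<Rightarrow> ('a, 'b \<Rightarrow> 'a) module"
  where "dual_mod R M = Hom_mod R M (regular_mod R)"

definition eval_map ::
    "('a, 'k) ring_scheme \<Rightarrow> ('a, 'b, 'm) module_scheme \<Rightarrow> 'b \<Rightarrow> (('b \<Rightarrow> 'a) \<Rightarrow> 'a)"
  where "eval_map R M = (\<lambda>m\<in>carrier M. \<lambda>\<psi>\<in>carrier (dual_mod R M). \<psi> m)"

definition reflexive_mod :: "('a, 'k) ring_scheme \<Rightarrow> ('a, 'b, 'm) module_scheme \<Rightarrow> bool"
  where "reflexive_mod R M \<longleftrightarrow> eval_map R M \<in> mod_iso R M (dual_mod R (dual_mod R M))"

definition submod_gen ::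
    "('a, 'k) ring_scheme \<Rightarrow> ('a, 'b, 'm) module_scheme \<Rightarrow> 'b set \<Rightarrow> 'b set"
  where "submod_gen R M S = \<Inter>{H. submodule H R M \<and> S \<subseteq> H}"

definition fin_gen_mod :: "('a, 'k) ring_scheme \<Rightarrow> ('a, 'b, 'm) module_scheme \<Rightarrow> bool"
  where "fin_gen_mod R M \<longleftrightarrow> (\<exists>S \<subseteq> carrier M. finite S \<and> submod_gen R M S = carrier M)"

definition faithful_mod :: "('a, 'k) ring_scheme \<Rightarrow> ('a, 'b, 'm) module_scheme \<Rightarrow> bool"
  where "faithful_mod R M \<longleftrightarrow>
    (\<forall>r \<in> carrier R. (\<forall>x \<in> carrier M. r \<odot>\<^bsub>M\<^esub> x = \<zero>\<^bsub>M\<^esub>) \<longrightarrow> r = \<zero>\<^bsub>R\<^esub>)"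


section \<open>Tensor products\<close>

definition free_mod :: "('a, 'k) ring_scheme \<Rightarrow> 'i set \<Rightarrow> ('a, 'i \<Rightarrow> 'a) module"
  where "free_mod R X =
    \<lparr>carrier = {f \<in> X \<rightarrow>\<^sub>E carrier R. finite {x \<in> X. f x \<noteq> \<zero>\<^bsub>R\<^esub>}}, monoid.mult = undefined, one = undefined,
     ring.zero = (\<lambda>x\<in>X. \<zero>\<^bsub>R\<^esub>),
     ring.add = (\<lambda>f g. \<lambda>x\<in>X. f x \<oplus>\<^bsub>R\<^esub> g x),
     smult = (\<lambda>r f. \<lambda>x\<in>X. r \<otimes>\<^bsub>R\<^esub> f x)\<rparr>"

definition free_basis :: "('a, 'k) ring_scheme \<Rightarrow> 'i set \<Rightarrow> 'i \<Rightarrow> 'i \<Rightarrow> 'a"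
  where "free_basis R X x = (\<lambda>y\<in>X. if y = x then \<one>\<^bsub>R\<^esub> else \<zero>\<^bsub>R\<^esub>)"

definition quot_mod ::
    "('a, 'k) ring_scheme \<Rightarrow> ('a, 'b, 'm) module_scheme \<Rightarrow> 'b set \<Rightarrow> ('a, 'b set) module"
  where "quot_mod R M H =
    \<lparr>carrier = a_rcosets\<^bsub>M\<^esub> H, monoid.mult = undefined, one = undefined,
     ring.zero = H, ring.add = set_add M,
     smult = (\<lambda>r C. \<Union>x\<in>C. H +>\<^bsub>M\<^esub> (r \<odot>\<^bsub>M\<^esub> x))\<rparr>"

definition tensor_free ::
    "('a, 'k) ring_scheme \<Rightarrow> ('a, 'b, 'm) module_scheme \<Rightarrow> ('a, 'c, 'n) module_scheme \<Rightarrow> ('a, 'b \<times> 'c \<Rightarrow> 'a) module"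
  where "tensor_free R M N = free_mod R (carrier M \<times> carrier N)"

definition tensor_rels ::
    "('a, 'k) ring_scheme \<Rightarrow> ('a, 'b, 'm) module_scheme \<Rightarrow> ('a, 'c, 'n) module_scheme \<Rightarrow> ('b \<times> 'c \<Rightarrow> 'a) set"
  where "tensor_rels R M N =
    (let F = tensor_free R M N; e = (\<lambda>x y. free_basis R (carrier M \<times> carrier N) (x, y)) in
      {e (x \<oplus>\<^bsub>M\<^esub> x') y \<ominus>\<^bsub>F\<^esub> (e x y \<oplus>\<^bsub>F\<^esub> e x' y) | x x' y. x \<in> carrier M \<and> x' \<in> carrier M \<and> y \<in> carrier N} \<union>
      {e x (y \<oplus>\<^bsub>N\<^esub> y') \<ominus>\<^bsub>F\<^esub> (e x y \<oplus>\<^bsub>F\<^esub> e x y') | x y y'. x \<in> carrier M \<and> y \<in> carrier N \<and> y' \<in> carrier N} \<union>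
      {e (r \<odot>\<^bsub>M\<^esub> x) y \<ominus>\<^bsub>F\<^esub> r \<odot>\<^bsub>F\<^esub> e x y | r x y. r \<in> carrier R \<and> x \<in> carrier M \<and> y \<in> carrier N} \<union>
      {e x (r \<odot>\<^bsub>N\<^esub> y) \<ominus>\<^bsub>F\<^esub> r \<odot>\<^bsub>F\<^esub> e x y | r x y. r \<in> carrier R \<and> x \<in> carrier M \<and> y \<in> carrier N})"

definition tensor_ker ::
    "('a, 'k) ring_scheme \<Rightarrow> ('a, 'b, 'm) module_scheme \<Rightarrow> ('a, 'c, 'n) module_scheme \<Rightarrow> ('b \<times> 'c \<Rightarrow> 'a) set"
  where "tensor_ker R M N = submod_gen R (tensor_free R M N) (tensor_rels R M N)"

definition tensor_mod ::
    "('a, 'k) ring_scheme \<Rightarrow> ('a, 'b, 'm) module_scheme \<Rightarrow> ('a, 'c, 'n) module_scheme \<Rightarrow> ('a, ('b \<times> 'c \<Rightarrow> 'a) set) module"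
  where "tensor_mod R M N = quot_mod R (tensor_free R M N) (tensor_ker R M N)"

definition pure_tensor ::
    "('a, 'k) ring_scheme \<Rightarrow> ('a, 'b, 'm) module_scheme \<Rightarrow> ('a, 'c, 'n) module_scheme \<Rightarrow> 'b \<Rightarrow> 'c \<Rightarrow> ('b \<times> 'c \<Rightarrow> 'a) set"
  where "pure_tensor R M N x y =
    tensor_ker R M N +>\<^bsub>tensor_free R M N\<^esub> free_basis R (carrier M \<times> carrier N) (x, y)"

text \<open>The linear map given on pure tensors by a bilinear \<open>b\<close> (well-defined by \<open>tensor_lift_ex1\<close>
  below).\<close>

definition tensor_lift ::
    "('a, 'k) ring_scheme \<Rightarrow> ('a, 'b, 'm) module_scheme \<Rightarrow> ('a, 'c, 'n) module_scheme \<Rightarrow> ('a, 'd, 'p) module_scheme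
      \<Rightarrow> ('b \<Rightarrow> 'c \<Rightarrow> 'd) \<Rightarrow> ('b \<times> 'c \<Rightarrow> 'a) set \<Rightarrow> 'd"
  where "tensor_lift R M N P b =
    (THE g. g \<in> lin_maps R (tensor_mod R M N) P \<and>
      (\<forall>x \<in> carrier M. \<forall>y \<in> carrier N. g (pure_tensor R M N x y) = b x y))"


subsection \<open>Universal property\<close>

lemma free_mod_simps:
  "carrier (free_mod R X) = {f \<in> X \<rightarrow>\<^sub>E carrier R. finite {x \<in> X. f x \<noteq> \<zero>\<^bsub>R\<^esub>}}"
  "\<zero>\<^bsub>free_mod R X\<^esub> = (\<lambda>x\<in>X. \<zero>\<^bsub>R\<^esub>)"
  "f \<oplus>\<^bsub>free_mod R X\<^esub> g = (\<lambda>x\<in>X. f x \<oplus>\<^bsub>R\<^esub> g x)"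
  "r \<odot>\<^bsub>free_mod R X\<^esub> f = (\<lambda>x\<in>X. r \<otimes>\<^bsub>R\<^esub> f x)"
  by (simp_all add: free_mod_def)

lemma (in cring) free_mod_module: "Module.module R (free_mod R X)"
proof (rule moduleI)
  show "abelian_group (free_mod R X)"
  proof (rule abelian_groupI)
    fix f g assume fg: "f \<in> carrier (free_mod R X)" "g \<in> carrier (free_mod R X)"
    have "finite ({x \<in> X. f x \<noteq> \<zero>} \<union> {x \<in> X. g x \<noteq> \<zero>})"
      using fg by (auto simp: free_mod_simps)
    moreover have "{x \<in> X. f x \<oplus> g x \<noteq> \<zero>} \<subseteq> {x \<in> X. f x \<noteq> \<zero>} \<union> {x \<in> X. g x \<noteq> \<zero>}" by auto
    ultimately have "finite {x \<in> X. f x \<oplus> g x \<noteq> \<zero>}" by (rule finite_subset[rotated])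
    moreover have "{x \<in> X. (\<lambda>x\<in>X. f x \<oplus> g x) x \<noteq> \<zero>} = {x \<in> X. f x \<oplus> g x \<noteq> \<zero>}" by auto
    ultimately show "f \<oplus>\<^bsub>free_mod R X\<^esub> g \<in> carrier (free_mod R X)"
      using fg by (auto simp: free_mod_simps PiE_iff)
  next
    fix f assume f: "f \<in> carrier (free_mod R X)"
    have *: "{x \<in> X. (\<lambda>x\<in>X. \<ominus> f x) x \<noteq> \<zero>} = {x \<in> X. f x \<noteq> \<zero>}" 
      using f by (auto simp: free_mod_simps PiE_iff)
    show "\<exists>y\<in>carrier (free_mod R X). y \<oplus>\<^bsub>free_mod R X\<^esub> f = \<zero>\<^bsub>free_mod R X\<^esub>"
      apply (rule bexI[of _ "\<lambda>x\<in>X. \<ominus> f x"])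
      using f * by (auto simp: free_mod_simps PiE_iff l_neg)
  qed (auto simp: free_mod_simps PiE_iff a_ac fun_eq_iff extensional_def)
next
  fix r f assume fg: "r \<in> carrier R" "f \<in> carrier (free_mod R X)"
  have "finite {x \<in> X. f x \<noteq> \<zero>}"
    using fg by (auto simp: free_mod_simps)
  moreover have "{x \<in> X. (\<lambda>x\<in>X. r \<otimes> f x) x \<noteq> \<zero>} \<subseteq> {x \<in> X. f x \<noteq> \<zero>}" using fg by auto
  ultimately have "finite {x \<in> X. (\<lambda>x\<in>X. r \<otimes> f x) x \<noteq> \<zero>}" by (rule finite_subset[rotated])
  then show "r \<odot>\<^bsub>free_mod R X\<^esub> f \<in> carrier (free_mod R X)"
    using fg by (auto simp: free_mod_simps PiE_iff)
qed (auto simp: is_cring free_mod_simps PiE_iff l_distr r_distr m_assoc fun_eq_iff extensional_def)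

lemma (in cring) free_basis_in: "x \<in> X \<Longrightarrow> free_basis R X x \<in> carrier (free_mod R X)"
proof -
  assume "x \<in> X"
  have "finite {y \<in> X. free_basis R X x y \<noteq> \<zero>}"
    by (rule finite_subset[of _ "{x}"]) (auto simp: free_basis_def split: if_splits)
  then show ?thesis by (auto simp: free_mod_simps free_basis_def PiE_iff extensional_def)
qed

lemma (in Module.module) submod_gen_submodule:
  assumes "S \<subseteq> carrier M" shows "submodule (submod_gen R M S) R M" "S \<subseteq> submod_gen R M S"
proof -
  have c: "carrier M \<in> {H. submodule H R M \<and> S \<subseteq> H}" using carrier_is_submodule assms by auto
  show "submodule (submod_gen R M S) R M" unfolding submod_gen_def
  proof (rule submoduleI)
    show "\<Inter> {H. submodule H R M \<and> S \<subseteq> H} \<subseteq> carrier M" using c by blast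
    show "\<zero>\<^bsub>M\<^esub> \<in> \<Inter> {H. submodule H R M \<and> S \<subseteq> H}" 
      by (auto simp: submodule_def dest!: subgroup.one_closed)
  qed (auto dest: submoduleE)
qed (auto simp: submod_gen_def)


definition lin_ext where
  "lin_ext R P X b f = finsum P (\<lambda>p. f p \<odot>\<^bsub>P\<^esub> b p) {p \<in> X. f p \<noteq> \<zero>\<^bsub>R\<^esub>}"

context
  fixes R (structure) and P :: "('a,'d,'p) module_scheme" and X :: "'i set" and b
  assumes P: "Module.module R P" and b: "b \<in> X \<rightarrow> carrier P"
begin

interpretation P: Module.module R P by (rule P)

lemma lin_ext_superset:
  assumes "f \<in> carrier (free_mod R X)" "finite S" "{p \<in> X. f p \<noteq> \<zero>} \<subseteq> S" "S \<subseteq> X"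
  shows "lin_ext R P X b f = finsum P (\<lambda>p. f p \<odot>\<^bsub>P\<^esub> b p) S"
  unfolding lin_ext_def
  apply (rule P.M.add.finprod_mono_neutral_cong_left)
  using assms b by (auto simp: free_mod_simps PiE_iff Pi_iff)

lemma lin_ext_closed: "f \<in> carrier (free_mod R X) \<Longrightarrow> lin_ext R P X b f \<in> carrier P"
  unfolding lin_ext_def using b by (auto intro!: P.M.finsum_closed simp: free_mod_simps PiE_iff Pi_iff)

lemma lin_ext_add:
  assumes f: "f \<in> carrier (free_mod R X)" and g: "g \<in> carrier (free_mod R X)"
  shows "lin_ext R P X b (f \<oplus>\<^bsub>free_mod R X\<^esub> g) = lin_ext R P X b f \<oplus>\<^bsub>P\<^esub> lin_ext R P X b g"
proof -
  interpret F: Module.module R "free_mod R X" by (rule P.free_mod_module)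
  let ?S = "{p \<in> X. f p \<noteq> \<zero>} \<union> {p \<in> X. g p \<noteq> \<zero>}"
  have S: "finite ?S" "?S \<subseteq> X" using f g by (auto simp: free_mod_simps)
  have fg: "f \<oplus>\<^bsub>free_mod R X\<^esub> g \<in> carrier (free_mod R X)" using f g by simp
  have cl: "f p \<in> carrier R" "g p \<in> carrier R" "b p \<in> carrier P" if "p \<in> X" for p
    using that f g b by (auto simp: free_mod_simps)
  have "lin_ext R P X b (f \<oplus>\<^bsub>free_mod R X\<^esub> g) = finsum P (\<lambda>p. (f \<oplus>\<^bsub>free_mod R X\<^esub> g) p \<odot>\<^bsub>P\<^esub> b p) ?S"
    by (rule lin_ext_superset[OF fg S(1) _ S(2)]) (auto simp: free_mod_simps)
  also have "\<dots> = finsum P (\<lambda>p. f p \<odot>\<^bsub>P\<^esub> b p \<oplus>\<^bsub>P\<^esub> g p \<odot>\<^bsub>P\<^esub> b p) ?S"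
    by (rule P.M.finsum_cong') (auto simp: free_mod_simps cl P.smult_l_distr)
  also have "\<dots> = finsum P (\<lambda>p. f p \<odot>\<^bsub>P\<^esub> b p) ?S \<oplus>\<^bsub>P\<^esub> finsum P (\<lambda>p. g p \<odot>\<^bsub>P\<^esub> b p) ?S"
    by (rule P.M.finsum_addf) (auto simp: cl)
  also have "finsum P (\<lambda>p. f p \<odot>\<^bsub>P\<^esub> b p) ?S = lin_ext R P X b f"
    by (rule lin_ext_superset[OF f S(1) _ S(2), symmetric]) auto
  also have "finsum P (\<lambda>p. g p \<odot>\<^bsub>P\<^esub> b p) ?S = lin_ext R P X b g"
    by (rule lin_ext_superset[OF g S(1) _ S(2), symmetric]) auto
  finally show ?thesis .
qed

lemma lin_ext_smult:
  assumes f: "f \<in> carrier (free_mod R X)" and r: "r \<in> carrier R"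
  shows "lin_ext R P X b (r \<odot>\<^bsub>free_mod R X\<^esub> f) = r \<odot>\<^bsub>P\<^esub> lin_ext R P X b f"
proof -
  interpret F: Module.module R "free_mod R X" by (rule P.free_mod_module)
  let ?S = "{p \<in> X. f p \<noteq> \<zero>}"
  have S: "finite ?S" "?S \<subseteq> X" using f by (auto simp: free_mod_simps)
  have fg: "r \<odot>\<^bsub>free_mod R X\<^esub> f \<in> carrier (free_mod R X)" using f r by simp
  have cl: "f p \<in> carrier R" "b p \<in> carrier P" if "p \<in> X" for p
    using that f b by (auto simp: free_mod_simps)
  have "lin_ext R P X b (r \<odot>\<^bsub>free_mod R X\<^esub> f) = finsum P (\<lambda>p. (r \<odot>\<^bsub>free_mod R X\<^esub> f) p \<odot>\<^bsub>P\<^esub> b p) ?S"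
    by (rule lin_ext_superset[OF fg S(1) _ S(2)]) (auto simp: free_mod_simps r)
  also have "\<dots> = finsum P (\<lambda>p. r \<odot>\<^bsub>P\<^esub> (f p \<odot>\<^bsub>P\<^esub> b p)) ?S"
    by (rule P.M.finsum_cong') (auto simp: free_mod_simps cl r P.smult_assoc1)
  also have "\<dots> = r \<odot>\<^bsub>P\<^esub> lin_ext R P X b f" unfolding lin_ext_def
    by (rule P.finsum_smult_ldistr[symmetric]) (auto simp: r cl S)
  finally show ?thesis .
qed

lemma lin_ext_basis:
  assumes x: "x \<in> X"
  shows "lin_ext R P X b (free_basis R X x) = b x"
proof -
  have "lin_ext R P X b (free_basis R X x) = finsum P (\<lambda>p. free_basis R X x p \<odot>\<^bsub>P\<^esub> b p) {x}"
    by (rule lin_ext_superset[OF P.free_basis_in[OF x]]) (auto simp: x free_basis_def)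
  also have "\<dots> = b x" using x b by (auto simp: free_basis_def Pi_iff)
  finally show ?thesis .
qed

lemma lin_ext_ker_submodule: "submodule {f \<in> carrier (free_mod R X). lin_ext R P X b f = \<zero>\<^bsub>P\<^esub>} R (free_mod R X)"
proof -
  interpret F: Module.module R "free_mod R X" by (rule P.free_mod_module)
  have z: "lin_ext R P X b \<zero>\<^bsub>free_mod R X\<^esub> = \<zero>\<^bsub>P\<^esub>"
    using lin_ext_smult[of "\<zero>\<^bsub>free_mod R X\<^esub>" "\<zero>"] lin_ext_closed[of "\<zero>\<^bsub>free_mod R X\<^esub>"] by simp
  show ?thesis
  proof (rule F.submoduleI)
    fix a assume "a \<in> {f \<in> carrier (free_mod R X). lin_ext R P X b f = \<zero>\<^bsub>P\<^esub>}"
    then show "\<ominus>\<^bsub>free_mod R X\<^esub> a \<in> {f \<in> carrier (free_mod R X). lin_ext R P X b f = \<zero>\<^bsub>P\<^esub>}"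
      using lin_ext_add[of a "\<ominus>\<^bsub>free_mod R X\<^esub> a"] z lin_ext_closed[of "\<ominus>\<^bsub>free_mod R X\<^esub> a"]
      by (auto simp: F.M.r_neg)
  qed (auto simp: z lin_ext_add lin_ext_smult)
qed

lemma lin_ext_minus:
  assumes "f \<in> carrier (free_mod R X)" "g \<in> carrier (free_mod R X)" "lin_ext R P X b f = lin_ext R P X b g"
  shows "lin_ext R P X b (f \<ominus>\<^bsub>free_mod R X\<^esub> g) = \<zero>\<^bsub>P\<^esub>"
proof -
  interpret F: Module.module R "free_mod R X" by (rule P.free_mod_module)
  have "lin_ext R P X b ((f \<ominus>\<^bsub>free_mod R X\<^esub> g) \<oplus>\<^bsub>free_mod R X\<^esub> g) = lin_ext R P X b g"
    using assms by (simp add: F.M.minus_eq F.M.a_assoc F.M.l_neg)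
  then show ?thesis using lin_ext_add[of "f \<ominus>\<^bsub>free_mod R X\<^esub> g" g] assms
     lin_ext_closed[of "f \<ominus>\<^bsub>free_mod R X\<^esub> g"] lin_ext_closed[of g]
    by (simp add: F.M.minus_closed)
qed

end

lemma tensor_lift_ex1:
  fixes R (structure)
  assumes M: "Module.module R M" and N: "Module.module R N" and P: "Module.module R P"
    and cl: "\<And>x y. x \<in> carrier M \<Longrightarrow> y \<in> carrier N \<Longrightarrow> b x y \<in> carrier P"
    and b1: "\<And>x x' y. x \<in> carrier M \<Longrightarrow> x' \<in> carrier M \<Longrightarrow> y \<in> carrier N \<Longrightarrow> b (x \<oplus>\<^bsub>M\<^esub> x') y = b x y \<oplus>\<^bsub>P\<^esub> b x' y"
    and b2: "\<And>x y y'. x \<in> carrier M \<Longrightarrow> y \<in> carrier N \<Longrightarrow> y' \<in> carrier N \<Longrightarrow> b x (y \<oplus>\<^bsub>N\<^esub> y') = b x y \<oplus>\<^bsub>P\<^esub> b x y'"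
    and b3: "\<And>r x y. r \<in> carrier R \<Longrightarrow> x \<in> carrier M \<Longrightarrow> y \<in> carrier N \<Longrightarrow> b (r \<odot>\<^bsub>M\<^esub> x) y = r \<odot>\<^bsub>P\<^esub> b x y"
    and b4: "\<And>r x y. r \<in> carrier R \<Longrightarrow> x \<in> carrier M \<Longrightarrow> y \<in> carrier N \<Longrightarrow> b x (r \<odot>\<^bsub>N\<^esub> y) = r \<odot>\<^bsub>P\<^esub> b x y"
  shows "\<exists>!g. g \<in> lin_maps R (tensor_mod R M N) P \<and>
      (\<forall>x \<in> carrier M. \<forall>y \<in> carrier N. g (pure_tensor R M N x y) = b x y)"
proof -
  interpret M: Module.module R M by (rule M)
  interpret N: Module.module R N by (rule N)
  interpret P: Module.module R P by (rule P)
  define X where "X = carrier M \<times> carrier N"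
  define F where "F = free_mod R X"
  define K where "K = tensor_ker R M N"
  define e where "e = free_basis R X"
  define G where "G = lin_ext R P X (\<lambda>p. b (fst p) (snd p))"
  interpret F: Module.module R F unfolding F_def by (rule M.free_mod_module)
  have bX: "(\<lambda>p. b (fst p) (snd p)) \<in> X \<rightarrow> carrier P" by (auto simp: X_def cl)
  note G = lin_ext_add[OF P bX, folded F_def G_def] lin_ext_smult[OF P bX, folded F_def G_def]
     lin_ext_basis[OF P bX, folded G_def e_def] lin_ext_minus[OF P bX, folded F_def G_def]
     lin_ext_closed[OF P bX, folded F_def G_def]
  note eF = M.free_basis_in[of _ X, folded F_def e_def]
  have X: "\<And>x y. x \<in> carrier M \<Longrightarrow> y \<in> carrier N \<Longrightarrow> (x,y) \<in> X" by (simp add: X_def)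
  have TF: "tensor_free R M N = F" by (simp add: tensor_free_def F_def X_def)
  have rels: "tensor_rels R M N \<subseteq> {f \<in> carrier F. G f = \<zero>\<^bsub>P\<^esub>}"
    unfolding tensor_rels_def Let_def TF
    unfolding X_def[symmetric] e_def[symmetric]
    by (auto intro!: G(4) simp: eF X G(1,2,3) b1 b2 b3 b4 cl)
  have KF: "submodule K R F"
    unfolding K_def tensor_ker_def TF by (rule F.submod_gen_submodule) (use rels in auto)
  have KG: "K \<subseteq> {f \<in> carrier F. G f = \<zero>\<^bsub>P\<^esub>}"
    unfolding K_def tensor_ker_def TF submod_gen_def
    using lin_ext_ker_submodule[OF P bX, folded F_def G_def] rels by blast
  interpret K: abelian_subgroup K F
    by (rule abelian_subgroupI3) (use KF submodule_def additive_subgroup_def F.M.abelian_group_axioms in blast)+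
  have T: "tensor_mod R M N = quot_mod R F K" by (simp add: tensor_mod_def TF K_def)
  have pt: "pure_tensor R M N x y = K +>\<^bsub>F\<^esub> e (x, y)" for x y
    by (simp add: pure_tensor_def TF K_def e_def X_def)
  have car: "carrier (quot_mod R F K) = {K +>\<^bsub>F\<^esub> f | f. f \<in> carrier F}"
    by (auto simp: quot_mod_def A_RCOSETS_def')
  have add: "(K +>\<^bsub>F\<^esub> f) \<oplus>\<^bsub>quot_mod R F K\<^esub> (K +>\<^bsub>F\<^esub> f') = K +>\<^bsub>F\<^esub> (f \<oplus>\<^bsub>F\<^esub> f')"
    if "f \<in> carrier F" "f' \<in> carrier F" for f f'
    using that K.a_rcos_sum by (auto simp: quot_mod_def)
  have mem: "f' \<in> K +>\<^bsub>F\<^esub> f \<longleftrightarrow> (\<exists>k\<in>K. f' = k \<oplus>\<^bsub>F\<^esub> f)" for f f'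
    by (auto simp: a_r_coset_def')
  have Kc: "k \<in> carrier F" if "k \<in> K" for k using KG that by auto
  have sm: "r \<odot>\<^bsub>quot_mod R F K\<^esub> (K +>\<^bsub>F\<^esub> f) = K +>\<^bsub>F\<^esub> (r \<odot>\<^bsub>F\<^esub> f)"
    if "r \<in> carrier R" "f \<in> carrier F" for r f
  proof -
    have "K +>\<^bsub>F\<^esub> (r \<odot>\<^bsub>F\<^esub> f') = K +>\<^bsub>F\<^esub> (r \<odot>\<^bsub>F\<^esub> f)" if f': "f' \<in> K +>\<^bsub>F\<^esub> f" for f'
    proof -
      obtain k where k: "k \<in> K" "f' = k \<oplus>\<^bsub>F\<^esub> f" using f' mem by auto
      have "r \<odot>\<^bsub>F\<^esub> f' = r \<odot>\<^bsub>F\<^esub> k \<oplus>\<^bsub>F\<^esub> r \<odot>\<^bsub>F\<^esub> f" 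
        using k Kc \<open>f \<in> carrier F\<close> \<open>r \<in> carrier R\<close> by (simp add: F.smult_r_distr)
      moreover have "r \<odot>\<^bsub>F\<^esub> k \<in> K" using k KF \<open>r \<in> carrier R\<close> F.submoduleE(4) by blast
      ultimately have "r \<odot>\<^bsub>F\<^esub> f' \<in> K +>\<^bsub>F\<^esub> (r \<odot>\<^bsub>F\<^esub> f)" using mem by blast
      then show ?thesis using K.a_repr_independence'[of "r \<odot>\<^bsub>F\<^esub> f'" "r \<odot>\<^bsub>F\<^esub> f"] \<open>f \<in> carrier F\<close> \<open>r \<in> carrier R\<close> by simp
    qed
    moreover have "K +>\<^bsub>F\<^esub> f \<noteq> {}" using K.a_rcos_self[OF \<open>f \<in> carrier F\<close>] by blast
    ultimately have "(\<Union>x\<in>K +>\<^bsub>F\<^esub> f. K +>\<^bsub>F\<^esub> (r \<odot>\<^bsub>F\<^esub> x)) = K +>\<^bsub>F\<^esub> (r \<odot>\<^bsub>F\<^esub> f)"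
      by (intro SUP_eq_const) blast+
    then show ?thesis by (simp add: quot_mod_def)
  qed
  have self: "f \<in> carrier F \<Longrightarrow> f \<in> K +>\<^bsub>F\<^esub> f" for f by (rule K.a_rcos_self)
  define g where "g = (\<lambda>C\<in>carrier (quot_mod R F K). G (SOME f. f \<in> C))"
  have gG: "g (K +>\<^bsub>F\<^esub> f) = G f" if f: "f \<in> carrier F" for f
  proof -
    have "(SOME f'. f' \<in> K +>\<^bsub>F\<^esub> f) \<in> K +>\<^bsub>F\<^esub> f" using self[OF f] by (rule someI[of "\<lambda>f'. f' \<in> K +>\<^bsub>F\<^esub> f"])
    then obtain k where k: "k \<in> K" "(SOME f'. f' \<in> K +>\<^bsub>F\<^esub> f) = k \<oplus>\<^bsub>F\<^esub> f" using mem by auto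
    have "G (k \<oplus>\<^bsub>F\<^esub> f) = G f" using G(1)[of k f] k KG f G(5)[OF f] by auto
    then show ?thesis using k f by (auto simp: g_def car)
  qed
  show ?thesis unfolding T
  proof (rule ex1I[of _ g])
    show "g \<in> lin_maps R (quot_mod R F K) P \<and> (\<forall>x\<in>carrier M. \<forall>y\<in>carrier N. g (pure_tensor R M N x y) = b x y)"
    proof (intro conjI ballI)
      have "g \<in> extensional (carrier (quot_mod R F K))" by (simp add: g_def)
      then show "g \<in> lin_maps R (quot_mod R F K) P"
        by (auto simp: lin_maps_def PiE_def car add sm gG G)
    qed (simp add: pt gG eF X G)
  next
    fix h assume h: "h \<in> lin_maps R (quot_mod R F K) P \<and> (\<forall>x\<in>carrier M. \<forall>y\<in>carrier N. h (pure_tensor R M N x y) = b x y)"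
    have hc: "h (K +>\<^bsub>F\<^esub> f) \<in> carrier P" if "f \<in> carrier F" for f
      using h that by (auto simp: lin_maps_def car)
    have ha: "h (K +>\<^bsub>F\<^esub> (f \<oplus>\<^bsub>F\<^esub> f')) = h (K +>\<^bsub>F\<^esub> f) \<oplus>\<^bsub>P\<^esub> h (K +>\<^bsub>F\<^esub> f')" if "f \<in> carrier F" "f' \<in> carrier F" for f f'
    proof -
      have c: "K +>\<^bsub>F\<^esub> f \<in> carrier (quot_mod R F K)" "K +>\<^bsub>F\<^esub> f' \<in> carrier (quot_mod R F K)"
        using that unfolding car by blast+
      have "h ((K +>\<^bsub>F\<^esub> f) \<oplus>\<^bsub>quot_mod R F K\<^esub> (K +>\<^bsub>F\<^esub> f')) = h (K +>\<^bsub>F\<^esub> f) \<oplus>\<^bsub>P\<^esub> h (K +>\<^bsub>F\<^esub> f')"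
        using h c unfolding lin_maps_def by blast
      then show ?thesis unfolding add[OF that] .
    qed
    have hs: "h (K +>\<^bsub>F\<^esub> (r \<odot>\<^bsub>F\<^esub> f)) = r \<odot>\<^bsub>P\<^esub> h (K +>\<^bsub>F\<^esub> f)" if "r \<in> carrier R" "f \<in> carrier F" for r f
    proof -
      have c: "K +>\<^bsub>F\<^esub> f \<in> carrier (quot_mod R F K)"
        using that unfolding car by blast
      have "h (r \<odot>\<^bsub>quot_mod R F K\<^esub> (K +>\<^bsub>F\<^esub> f)) = r \<odot>\<^bsub>P\<^esub> h (K +>\<^bsub>F\<^esub> f)"
        using h c that unfolding lin_maps_def by blast
      then show ?thesis unfolding sm[OF that] .
    qed
    have hb: "h (K +>\<^bsub>F\<^esub> e p) = G (e p)" if "p \<in> X" for p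
      using h that by (auto simp: pt G X_def)
    have key: "finite S \<Longrightarrow> S \<subseteq> X \<Longrightarrow> \<forall>f\<in>carrier F. {p \<in> X. f p \<noteq> \<zero>} \<subseteq> S \<longrightarrow> h (K +>\<^bsub>F\<^esub> f) = G f" for S
    proof (induction S rule: finite_induct)
      case empty
      show ?case
      proof (intro ballI impI)
        fix f assume f: "f \<in> carrier F" "{p \<in> X. f p \<noteq> \<zero>} \<subseteq> {}"
        have "f = \<zero> \<odot>\<^bsub>F\<^esub> f" using f by (auto simp: F_def free_mod_simps PiE_iff extensional_def fun_eq_iff)
        then show "h (K +>\<^bsub>F\<^esub> f) = G f" using hs[of \<zero> f] G(2)[of f \<zero>] f hc[of f] G(5)[of f] by simp
      qed
    next
      case (insert q S)
      show ?case
      proof (intro ballI impI)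
        fix f assume f: "f \<in> carrier F" "{p \<in> X. f p \<noteq> \<zero>} \<subseteq> insert q S"
        have q: "q \<in> X" using insert by auto
        have fq: "f q \<in> carrier R" using f q by (auto simp: F_def free_mod_simps)
        define f' where "f' = (\<lambda>p\<in>X. if p = q then \<zero> else f p)"
        have "{p \<in> X. f' p \<noteq> \<zero>} \<subseteq> {p \<in> X. f p \<noteq> \<zero>}" by (auto simp: f'_def)
        moreover have "finite {p \<in> X. f p \<noteq> \<zero>}" using f by (auto simp: F_def free_mod_simps)
        ultimately have "finite {p \<in> X. f' p \<noteq> \<zero>}" by (rule finite_subset)
        moreover have "f' \<in> X \<rightarrow>\<^sub>E carrier R"
          using f by (auto simp: F_def free_mod_simps f'_def PiE_iff)
        ultimately have f': "f' \<in> carrier F" by (simp add: F_def free_mod_simps)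
        have s: "{p \<in> X. f' p \<noteq> \<zero>} \<subseteq> S" using f by (auto simp: f'_def)
        have eq: "f = f' \<oplus>\<^bsub>F\<^esub> f q \<odot>\<^bsub>F\<^esub> e q"
          using f q fq by (auto simp: F_def free_mod_simps f'_def e_def free_basis_def PiE_iff extensional_def fun_eq_iff)
        have eq': "e q \<in> carrier F" using eF q by simp
        have *: "h (K +>\<^bsub>F\<^esub> f') = G f'" using insert f' s by auto
        have "h (K +>\<^bsub>F\<^esub> (f' \<oplus>\<^bsub>F\<^esub> f q \<odot>\<^bsub>F\<^esub> e q)) = G (f' \<oplus>\<^bsub>F\<^esub> f q \<odot>\<^bsub>F\<^esub> e q)"
          using f' fq eq' * hb[OF q] by (simp add: ha hs G(1,2))
        then show "h (K +>\<^bsub>F\<^esub> f) = G f" using eq by simp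
      qed
    qed
    have hG: "h (K +>\<^bsub>F\<^esub> f) = G f" if "f \<in> carrier F" for f
      using key[of "{p \<in> X. f p \<noteq> \<zero>}"] that by (auto simp: F_def free_mod_simps)
    show "h = g"
    proof (rule PiE_ext[where k = "carrier (quot_mod R F K)" and s = "\<lambda>_. carrier P"])
      show "h \<in> carrier (quot_mod R F K) \<rightarrow>\<^sub>E carrier P" using h by (simp add: lin_maps_def)
      show "g \<in> carrier (quot_mod R F K) \<rightarrow>\<^sub>E carrier P" by (auto simp: PiE_iff car gG G) (simp add: g_def car)
    qed (auto simp: car gG hG)
  qed
qed


section \<open>The trace ideal and the map \<open>\<sigma>\<close>\<close>

definition trace_ideal :: "('a, 'k) ring_scheme \<Rightarrow> ('a, 'b, 'm) module_scheme \<Rightarrow> 'a set"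
  where "trace_ideal R M = {finsum R c F | c F.
    finite F \<and> F \<subseteq> carrier (dual_mod R M) \<and> (\<forall>\<alpha> \<in> F. c \<alpha> \<in> \<alpha> ` carrier M)}"

definition trace_mod :: "('a, 'k) ring_scheme \<Rightarrow> ('a, 'b, 'm) module_scheme \<Rightarrow> ('a, 'a) module"
  where "trace_mod R M = (regular_mod R)\<lparr>carrier := trace_ideal R M\<rparr>"

definition trace_map ::
    "('a, 'k) ring_scheme \<Rightarrow> ('a, 'b, 'm) module_scheme \<Rightarrow> ('b \<times> ('b \<Rightarrow> 'a) \<Rightarrow> 'a) set \<Rightarrow> 'a"
  where "trace_map R M = tensor_lift R M (dual_mod R M) (regular_mod R) (\<lambda>m \<alpha>. \<alpha> m)"

definition theta ::
    "('a, 'k) ring_scheme \<Rightarrow> ('a, 'b, 'm) module_scheme \<Rightarrow> ('b \<Rightarrow> 'b) \<Rightarrow> ('b \<times> ('b \<Rightarrow> 'a) \<Rightarrow> 'a) set \<Rightarrow> 'a"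
  where "theta R M f = tensor_lift R M (dual_mod R M) (regular_mod R) (\<lambda>m \<alpha>. \<alpha> (f m))"

definition trace_pullback ::
    "('a, 'k) ring_scheme \<Rightarrow> ('a, 'b, 'm) module_scheme \<Rightarrow> ('a \<Rightarrow> 'a) \<Rightarrow> ('b \<times> ('b \<Rightarrow> 'a) \<Rightarrow> 'a) set \<Rightarrow> 'a"
  where "trace_pullback R M h = compose (carrier (tensor_mod R M (dual_mod R M))) h (trace_map R M)"

text \<open>As maps are extensional and \<open>trace_ideal R M \<subseteq> carrier R\<close>, an endomorphism of the trace ideal
  is literally an element of \<open>lin_maps R (trace_mod R M) (regular_mod R)\<close>. For reflexive \<open>M\<close> the map
  \<open>theta\<close> is a bijection from \<open>carrier (End_alg R M)\<close> onto the linear maps from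
  \<open>tensor_mod R M (dual_mod R M)\<close> to \<open>regular_mod R\<close>, so \<open>inv_into\<close> below is its inverse.\<close>

definition sigma ::
    "('a, 'k) ring_scheme \<Rightarrow> ('a, 'b, 'm) module_scheme \<Rightarrow> ('a \<Rightarrow> 'a) \<Rightarrow> ('b \<Rightarrow> 'b)"
  where "sigma R M h = inv_into (carrier (End_alg R M)) (theta R M) (trace_pullback R M h)"

end

theory Submission
  imports Defs
begin

text \<open>
  The endomorphism \<open>\<sigma>(h)\<close> is characterised by \<open>\<alpha>(\<sigma>(h)(m)) = h(\<alpha>(m))\<close> for all \<open>m \<in> M\<close> and
  \<open>\<alpha> \<in> M\<^sup>*\<close>. Replacing \<open>\<alpha>\<close> by \<open>\<alpha> \<circ> g\<close> shows that \<open>\<sigma>(h)\<close> commutes with every endomorphism \<open>g\<close>,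
  and \<open>\<sigma>\<close> is injective because the elements \<open>\<alpha>(m)\<close> generate the trace ideal. Conversely, a
  central \<open>f\<close> commutes with the endomorphism \<open>y \<mapsto> \<alpha>(y) m\<close>, so \<open>\<alpha>(f(x)) m = \<alpha>(x) f(m)\<close>. Thus
  every \<open>r\<close> in the trace ideal admits an \<open>s\<close> in the trace ideal with \<open>s m = r f(m)\<close> for all \<open>m\<close>; it is
  unique as \<open>M\<close> is faithful, and \<open>r \<mapsto> s\<close> is the preimage of \<open>f\<close>.
\<close>

section \<open>Bilinear maps and modules of homomorphisms\<close>

text \<open>Packages the hypotheses of \<open>tensor_lift_ex1\<close> on \<open>b\<close>, so that
  they can be passed around as a single fact.\<close>

definition bilinear ::
    "('a, 'k) ring_scheme \<Rightarrow> ('a, 'b, 'm) module_scheme \<Rightarrow> ('a, 'c, 'n) module_scheme \<Rightarrow> ('a, 'd, 'p) module_scheme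
      \<Rightarrow> ('b \<Rightarrow> 'c \<Rightarrow> 'd) \<Rightarrow> bool"
  where "bilinear R M N P b \<longleftrightarrow>
    (\<forall>x\<in>carrier M. \<forall>y\<in>carrier N. b x y \<in> carrier P) \<and>
    (\<forall>x\<in>carrier M. \<forall>x'\<in>carrier M. \<forall>y\<in>carrier N. b (x \<oplus>\<^bsub>M\<^esub> x') y = b x y \<oplus>\<^bsub>P\<^esub> b x' y) \<and>
    (\<forall>x\<in>carrier M. \<forall>y\<in>carrier N. \<forall>y'\<in>carrier N. b x (y \<oplus>\<^bsub>N\<^esub> y') = b x y \<oplus>\<^bsub>P\<^esub> b x y') \<and>
    (\<forall>r\<in>carrier R. \<forall>x\<in>carrier M. \<forall>y\<in>carrier N. b (r \<odot>\<^bsub>M\<^esub> x) y = r \<odot>\<^bsub>P\<^esub> b x y) \<and>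
    (\<forall>r\<in>carrier R. \<forall>x\<in>carrier M. \<forall>y\<in>carrier N. b x (r \<odot>\<^bsub>N\<^esub> y) = r \<odot>\<^bsub>P\<^esub> b x y)"

lemma bilinear_ex1:
  assumes "Module.module R M" "Module.module R N" "Module.module R P" "bilinear R M N P b"
  shows "\<exists>!g. g \<in> lin_maps R (tensor_mod R M N) P \<and>
      (\<forall>x \<in> carrier M. \<forall>y \<in> carrier N. g (pure_tensor R M N x y) = b x y)"
  by (rule tensor_lift_ex1[OF assms(1-3)]; use assms(4) in \<open>simp add: bilinear_def\<close>)

lemma tensor_lift:
  assumes "Module.module R M" "Module.module R N" "Module.module R P" "bilinear R M N P b"
  shows tensor_lift_lin: "tensor_lift R M N P b \<in> lin_maps R (tensor_mod R M N) P"
    and tensor_lift_pure: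
      "\<And>x y. x \<in> carrier M \<Longrightarrow> y \<in> carrier N \<Longrightarrow> tensor_lift R M N P b (pure_tensor R M N x y) = b x y"
  using theI'[OF bilinear_ex1[OF assms]] by (simp_all add: tensor_lift_def)

text \<open>Uniqueness in the universal property: a linear map on a tensor product is identified by
  its values on pure tensors, without decomposing a general element.\<close>

lemma tensor_lift_eqI:
  assumes "Module.module R M" "Module.module R N" "Module.module R P" "bilinear R M N P b"
    and "g \<in> lin_maps R (tensor_mod R M N) P"
    and "\<And>x y. x \<in> carrier M \<Longrightarrow> y \<in> carrier N \<Longrightarrow> g (pure_tensor R M N x y) = b x y"
  shows "tensor_lift R M N P b = g"
  using the1_equality[OF bilinear_ex1[OF assms(1-4)], of g] assms(5,6) by (simp add: tensor_lift_def)

lemma (in cring) pure_tensor_closed: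
  assumes "x \<in> carrier M" "y \<in> carrier N"
  shows "pure_tensor R M N x y \<in> carrier (tensor_mod R M N)"
  using free_basis_in[of "(x, y)" "carrier M \<times> carrier N"] assms
  by (auto simp: tensor_mod_def quot_mod_def pure_tensor_def A_RCOSETS_def' tensor_free_def)

text \<open>A map built with \<open>compose\<close> has its intended value only on the carrier, so
  checking that it is linear on a quotient requires sums and multiples of cosets to be cosets
  again.\<close>

lemma (in Module.module) quot_mod_closed:
  assumes H: "submodule H R M"
  shows "C \<in> carrier (quot_mod R M H) \<Longrightarrow> D \<in> carrier (quot_mod R M H)
      \<Longrightarrow> C \<oplus>\<^bsub>quot_mod R M H\<^esub> D \<in> carrier (quot_mod R M H)"
    and "r \<in> carrier R \<Longrightarrow> C \<in> carrier (quot_mod R M H)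
      \<Longrightarrow> r \<odot>\<^bsub>quot_mod R M H\<^esub> C \<in> carrier (quot_mod R M H)"
proof -
  interpret H: abelian_subgroup H M
    by (rule abelian_subgroupI3) (use H submodule_def additive_subgroup_def M.abelian_group_axioms in blast)+
  have car: "carrier (quot_mod R M H) = {H +>\<^bsub>M\<^esub> x | x. x \<in> carrier M}"
    by (auto simp: quot_mod_def A_RCOSETS_def')
  show "C \<oplus>\<^bsub>quot_mod R M H\<^esub> D \<in> carrier (quot_mod R M H)"
    if C: "C \<in> carrier (quot_mod R M H)" and D: "D \<in> carrier (quot_mod R M H)"
  proof -
    obtain x y where xy: "C = H +>\<^bsub>M\<^esub> x" "x \<in> carrier M" "D = H +>\<^bsub>M\<^esub> y" "y \<in> carrier M"
      using C D unfolding car by blast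
    then have "C \<oplus>\<^bsub>quot_mod R M H\<^esub> D = H +>\<^bsub>M\<^esub> (x \<oplus>\<^bsub>M\<^esub> y)"
      using H.a_rcos_sum by (simp add: quot_mod_def)
    then show ?thesis using xy car by auto
  qed
  show "r \<odot>\<^bsub>quot_mod R M H\<^esub> C \<in> carrier (quot_mod R M H)"
    if r: "r \<in> carrier R" and C: "C \<in> carrier (quot_mod R M H)"
  proof -
    obtain x where x: "C = H +>\<^bsub>M\<^esub> x" "x \<in> carrier M" using C unfolding car by blast
    \<comment> \<open>A multiple of a coset is defined as a union over representatives. Changing the
      representative by \<open>k\<close> in \<open>H\<close> changes its multiple by
      \<open>r\<close> times \<open>k\<close>, again in \<open>H\<close>, so all cosets in the union
      coincide.\<close>
    have "H +>\<^bsub>M\<^esub> (r \<odot>\<^bsub>M\<^esub> y) = H +>\<^bsub>M\<^esub> (r \<odot>\<^bsub>M\<^esub> x)" if y: "y \<in> H +>\<^bsub>M\<^esub> x" for y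
    proof -
      obtain k where k: "k \<in> H" "y = k \<oplus>\<^bsub>M\<^esub> x" using y by (auto simp: a_r_coset_def')
      have "r \<odot>\<^bsub>M\<^esub> y = r \<odot>\<^bsub>M\<^esub> k \<oplus>\<^bsub>M\<^esub> r \<odot>\<^bsub>M\<^esub> x"
        using k H.a_Hcarr x(2) r by (simp add: smult_r_distr)
      moreover have "r \<odot>\<^bsub>M\<^esub> k \<in> H" using submoduleE(4)[OF H] k r by blast
      ultimately have "r \<odot>\<^bsub>M\<^esub> y \<in> H +>\<^bsub>M\<^esub> (r \<odot>\<^bsub>M\<^esub> x)" by (auto simp: a_r_coset_def')
      then show ?thesis using H.a_repr_independence'[of "r \<odot>\<^bsub>M\<^esub> y" "r \<odot>\<^bsub>M\<^esub> x"] x(2) r by simp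
    qed
    moreover have "H +>\<^bsub>M\<^esub> x \<noteq> {}" using H.a_rcos_self[OF x(2)] by blast
    ultimately have "(\<Union>y\<in>C. H +>\<^bsub>M\<^esub> (r \<odot>\<^bsub>M\<^esub> y)) = H +>\<^bsub>M\<^esub> (r \<odot>\<^bsub>M\<^esub> x)"
      unfolding x(1) by (intro SUP_eq_const) blast+
    then show ?thesis using x(2) r car by (auto simp: quot_mod_def)
  qed
qed

lemma tensor_mod_closed:
  assumes M: "Module.module R M" and N: "Module.module R N"
  shows "C \<in> carrier (tensor_mod R M N) \<Longrightarrow> D \<in> carrier (tensor_mod R M N)
      \<Longrightarrow> C \<oplus>\<^bsub>tensor_mod R M N\<^esub> D \<in> carrier (tensor_mod R M N)"
    and "r \<in> carrier R \<Longrightarrow> C \<in> carrier (tensor_mod R M N)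
      \<Longrightarrow> r \<odot>\<^bsub>tensor_mod R M N\<^esub> C \<in> carrier (tensor_mod R M N)"
proof -
  interpret M: Module.module R M by (rule M)
  interpret N: Module.module R N by (rule N)
  interpret F: Module.module R "tensor_free R M N"
    unfolding tensor_free_def by (rule M.free_mod_module)
  have e: "free_basis R (carrier M \<times> carrier N) (x, y) \<in> carrier (tensor_free R M N)"
    if "x \<in> carrier M" "y \<in> carrier N" for x y
    using that M.free_basis_in[of "(x, y)" "carrier M \<times> carrier N"] by (simp add: tensor_free_def)
  \<comment> \<open>Generators inside the carrier make \<open>tensor_ker\<close> a submodule, so
    closure of quotients applies to it.\<close>
  have "tensor_rels R M N \<subseteq> carrier (tensor_free R M N)"
    unfolding tensor_rels_def Let_def by (auto intro!: F.M.minus_closed F.M.a_closed F.smult_closed e)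
  then have "submodule (tensor_ker R M N) R (tensor_free R M N)"
    unfolding tensor_ker_def by (rule F.submod_gen_submodule)
  note closed = F.quot_mod_closed[OF this, folded tensor_mod_def]
  show "C \<in> carrier (tensor_mod R M N) \<Longrightarrow> D \<in> carrier (tensor_mod R M N)
      \<Longrightarrow> C \<oplus>\<^bsub>tensor_mod R M N\<^esub> D \<in> carrier (tensor_mod R M N)"
    and "r \<in> carrier R \<Longrightarrow> C \<in> carrier (tensor_mod R M N)
      \<Longrightarrow> r \<odot>\<^bsub>tensor_mod R M N\<^esub> C \<in> carrier (tensor_mod R M N)"
    by (fact closed)+
qed

section \<open>Linear maps and the modules they form\<close>

lemma regular_mod_simps [simp]:
  "carrier (regular_mod R) = carrier R"
  "\<zero>\<^bsub>regular_mod R\<^esub> = \<zero>\<^bsub>R\<^esub>"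
  "x \<oplus>\<^bsub>regular_mod R\<^esub> y = x \<oplus>\<^bsub>R\<^esub> y"
  "x \<odot>\<^bsub>regular_mod R\<^esub> y = x \<otimes>\<^bsub>R\<^esub> y"
  by (simp_all add: regular_mod_def)

lemma trace_mod_simps [simp]:
  "carrier (trace_mod R M) = trace_ideal R M"
  "\<zero>\<^bsub>trace_mod R M\<^esub> = \<zero>\<^bsub>R\<^esub>"
  "x \<oplus>\<^bsub>trace_mod R M\<^esub> y = x \<oplus>\<^bsub>R\<^esub> y"
  "x \<odot>\<^bsub>trace_mod R M\<^esub> y = x \<otimes>\<^bsub>R\<^esub> y"
  by (simp_all add: regular_mod_def trace_mod_def)

lemma Hom_mod_simps:
  "carrier (Hom_mod R M N) = lin_maps R M N"
  "\<zero>\<^bsub>Hom_mod R M N\<^esub> = (\<lambda>x\<in>carrier M. \<zero>\<^bsub>N\<^esub>)"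
  "f \<oplus>\<^bsub>Hom_mod R M N\<^esub> g = (\<lambda>x\<in>carrier M. f x \<oplus>\<^bsub>N\<^esub> g x)"
  "r \<odot>\<^bsub>Hom_mod R M N\<^esub> f = (\<lambda>x\<in>carrier M. r \<odot>\<^bsub>N\<^esub> f x)"
  by (simp_all add: Hom_mod_def)

lemma dual_mod_simps:
  "carrier (dual_mod R M) = lin_maps R M (regular_mod R)"
  "\<zero>\<^bsub>dual_mod R M\<^esub> = (\<lambda>x\<in>carrier M. \<zero>\<^bsub>R\<^esub>)"
  "f \<oplus>\<^bsub>dual_mod R M\<^esub> g = (\<lambda>x\<in>carrier M. f x \<oplus>\<^bsub>R\<^esub> g x)"
  "r \<odot>\<^bsub>dual_mod R M\<^esub> f = (\<lambda>x\<in>carrier M. r \<otimes>\<^bsub>R\<^esub> f x)"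
  by (simp_all add: dual_mod_def Hom_mod_simps)

lemma End_alg_simps:
  "carrier (End_alg R M) = lin_maps R M M"
  "f \<oplus>\<^bsub>End_alg R M\<^esub> g = (\<lambda>x\<in>carrier M. f x \<oplus>\<^bsub>M\<^esub> g x)"
  "r \<odot>\<^bsub>End_alg R M\<^esub> f = (\<lambda>x\<in>carrier M. r \<odot>\<^bsub>M\<^esub> f x)"
  "f \<otimes>\<^bsub>End_alg R M\<^esub> g = compose (carrier M) f g"
  "\<one>\<^bsub>End_alg R M\<^esub> = (\<lambda>x\<in>carrier M. x)"
  by (simp_all add: End_alg_def Hom_mod_def)

lemma center_alg_simps:
  "carrier (center_alg A) = {z \<in> carrier A. \<forall>a \<in> carrier A. z \<otimes>\<^bsub>A\<^esub> a = a \<otimes>\<^bsub>A\<^esub> z}"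
  "f \<oplus>\<^bsub>center_alg A\<^esub> g = f \<oplus>\<^bsub>A\<^esub> g"
  "r \<odot>\<^bsub>center_alg A\<^esub> f = r \<odot>\<^bsub>A\<^esub> f"
  "f \<otimes>\<^bsub>center_alg A\<^esub> g = f \<otimes>\<^bsub>A\<^esub> g"
  "\<one>\<^bsub>center_alg A\<^esub> = \<one>\<^bsub>A\<^esub>"
  by (simp_all add: center_alg_def)

lemma lin_mapsI:
  assumes "\<And>x. x \<in> carrier M \<Longrightarrow> f x \<in> carrier N" "f \<in> extensional (carrier M)"
    and "\<And>x y. x \<in> carrier M \<Longrightarrow> y \<in> carrier M \<Longrightarrow> f (x \<oplus>\<^bsub>M\<^esub> y) = f x \<oplus>\<^bsub>N\<^esub> f y"
    and "\<And>r x. r \<in> carrier R \<Longrightarrow> x \<in> carrier M \<Longrightarrow> f (r \<odot>\<^bsub>M\<^esub> x) = r \<odot>\<^bsub>N\<^esub> f x"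
  shows "f \<in> lin_maps R M N"
  using assms by (auto simp: lin_maps_def PiE_def)

lemma lin_mapsD:
  assumes "f \<in> lin_maps R M N"
  shows "\<And>x. x \<in> carrier M \<Longrightarrow> f x \<in> carrier N"
    and "f \<in> extensional (carrier M)"
    and "\<And>x y. x \<in> carrier M \<Longrightarrow> y \<in> carrier M \<Longrightarrow> f (x \<oplus>\<^bsub>M\<^esub> y) = f x \<oplus>\<^bsub>N\<^esub> f y"
    and "\<And>r x. r \<in> carrier R \<Longrightarrow> x \<in> carrier M \<Longrightarrow> f (r \<odot>\<^bsub>M\<^esub> x) = r \<odot>\<^bsub>N\<^esub> f x"
  using assms by (auto simp: lin_maps_def PiE_def)

lemma lin_maps_eqI:
  assumes "f \<in> lin_maps R M N" "g \<in> lin_maps R M N" "\<And>x. x \<in> carrier M \<Longrightarrow> f x = g x"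
  shows "f = g"
  by (rule extensionalityI[OF lin_mapsD(2)[OF assms(1)] lin_mapsD(2)[OF assms(2)] assms(3)])

lemma (in Module.module) lin_maps_compose:
  assumes f: "f \<in> lin_maps R N P" and g: "g \<in> lin_maps R M N"
  shows "compose (carrier M) f g \<in> lin_maps R M P"
  by (rule lin_mapsI) (simp_all add: compose_def lin_mapsD[OF f] lin_mapsD[OF g])

lemma (in cring) regular_mod_module: "Module.module R (regular_mod R)"
  by (rule moduleI) (auto intro!: abelian_groupI simp: is_cring a_ac m_assoc l_distr r_distr
      intro: bexI[of _ "\<ominus> _"] l_neg)

context
  fixes R :: "('a, 'k) ring_scheme" and M :: "('a, 'b, 'm) module_scheme" and N :: "('a, 'c, 'n) module_scheme"
  assumes M: "Module.module R M" and N: "Module.module R N"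
begin

interpretation M: Module.module R M by (rule M)
interpretation N: Module.module R N by (rule N)

lemma lin_maps_add:
  assumes f: "f \<in> lin_maps R M N" and g: "g \<in> lin_maps R M N"
  shows "(\<lambda>x\<in>carrier M. f x \<oplus>\<^bsub>N\<^esub> g x) \<in> lin_maps R M N"
  by (rule lin_mapsI) (simp_all add: lin_mapsD[OF f] lin_mapsD[OF g] N.M.a_ac N.smult_r_distr)

lemma lin_maps_smult:
  assumes f: "f \<in> lin_maps R M N" and r: "r \<in> carrier R"
  shows "(\<lambda>x\<in>carrier M. r \<odot>\<^bsub>N\<^esub> f x) \<in> lin_maps R M N"
proof (rule lin_mapsI)
  fix s x assume s: "s \<in> carrier R" and x: "x \<in> carrier M"
  \<comment> \<open>Commutativity of \<open>R\<close> lets the two scalars change places; this makes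
    a multiple of a linear map linear.\<close>
  have "r \<odot>\<^bsub>N\<^esub> (s \<odot>\<^bsub>N\<^esub> f x) = (s \<otimes>\<^bsub>R\<^esub> r) \<odot>\<^bsub>N\<^esub> f x"
    using r s x lin_mapsD(1)[OF f] by (metis N.smult_assoc1 M.R.m_comm)
  then show "(\<lambda>x\<in>carrier M. r \<odot>\<^bsub>N\<^esub> f x) (s \<odot>\<^bsub>M\<^esub> x) = s \<odot>\<^bsub>N\<^esub> (\<lambda>x\<in>carrier M. r \<odot>\<^bsub>N\<^esub> f x) x"
    using r s x lin_mapsD[OF f] by (simp add: N.smult_assoc1)
qed (simp_all add: lin_mapsD[OF f] r N.smult_r_distr)

lemma lin_maps_zero: "(\<lambda>x\<in>carrier M. \<zero>\<^bsub>N\<^esub>) \<in> lin_maps R M N"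
  by (rule lin_mapsI) simp_all

lemma lin_maps_minus:
  assumes f: "f \<in> lin_maps R M N"
  shows "(\<lambda>x\<in>carrier M. \<ominus>\<^bsub>N\<^esub> f x) \<in> lin_maps R M N"
  by (rule lin_mapsI) (simp_all add: lin_mapsD[OF f] N.M.minus_add N.smult_r_minus)

text \<open>With the ring itself as \<open>N\<close>, this makes the dual a module, as required of
  the second tensor factor.\<close>

lemma Hom_mod_module: "Module.module R (Hom_mod R M N)"
proof -
  note cl = lin_mapsD(1)[of _ R M N]
  \<comment> \<open>The laws for zero and one have a bare \<open>f\<close> on one side, so they must
    also be checked outside the carrier, where \<open>f\<close> is \<open>undefined\<close>.\<close>
  note arb = extensional_arb[OF lin_mapsD(2)[of _ R M N]]
  note ops = lin_maps_add lin_maps_smult lin_maps_zero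
  show ?thesis
  proof (rule moduleI)
    show "abelian_group (Hom_mod R M N)"
    proof (rule abelian_groupI, unfold Hom_mod_simps)
      fix f assume f: "f \<in> lin_maps R M N"
      then show "\<exists>g\<in>lin_maps R M N. (\<lambda>x\<in>carrier M. g x \<oplus>\<^bsub>N\<^esub> f x) = (\<lambda>x\<in>carrier M. \<zero>\<^bsub>N\<^esub>)"
        by (intro bexI[OF _ lin_maps_minus[OF f]]) (simp add: fun_eq_iff restrict_def N.M.l_neg cl)
    next
      fix f assume f: "f \<in> lin_maps R M N"
      then show "(\<lambda>x\<in>carrier M. (\<lambda>x\<in>carrier M. \<zero>\<^bsub>N\<^esub>) x \<oplus>\<^bsub>N\<^esub> f x) = f"
        by (simp add: fun_eq_iff restrict_def cl arb)
    qed (simp_all add: ops N.M.a_ac cl cong: restrict_cong)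
  next
    fix f assume "f \<in> carrier (Hom_mod R M N)"
    then show "\<one>\<^bsub>R\<^esub> \<odot>\<^bsub>Hom_mod R M N\<^esub> f = f"
      by (simp add: Hom_mod_simps fun_eq_iff restrict_def cl arb)
  qed (simp_all add: Hom_mod_simps ops M.R.is_cring cl N.smult_l_distr N.smult_r_distr
      N.smult_assoc1 cong: restrict_cong)
qed

end

lemma (in Module.module) dual_mod_module: "Module.module R (dual_mod R M)"
  unfolding dual_mod_def by (rule Hom_mod_module[OF module_axioms regular_mod_module])

section \<open>The trace ideal\<close>

context Module.module
begin

lemmas dualD = lin_mapsD[of _ R M "regular_mod R", simplified, folded dual_mod_simps(1)]

lemma dual_image_closed:
  assumes "\<alpha> \<in> F" "F \<subseteq> carrier (dual_mod R M)" "\<forall>\<alpha>\<in>F. c \<alpha> \<in> \<alpha> ` carrier M"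
  shows "c \<alpha> \<in> carrier R"
proof -
  obtain x where "x \<in> carrier M" "c \<alpha> = \<alpha> x" using assms by blast
  then show ?thesis using dualD(1)[of \<alpha> x] assms by auto
qed

lemma trace_ideal_subset: "trace_ideal R M \<subseteq> carrier R"
  unfolding trace_ideal_def by (auto intro!: R.finsum_closed simp: dual_image_closed)

lemma trace_ideal_gen:
  assumes "\<alpha> \<in> carrier (dual_mod R M)" "x \<in> carrier M"
  shows "\<alpha> x \<in> trace_ideal R M"
proof -
  have "\<alpha> x = finsum R (\<lambda>_. \<alpha> x) {\<alpha>}" using assms dualD(1) by simp
  then show ?thesis unfolding trace_ideal_def using assms by blast
qed

lemma trace_ideal_zero: "\<zero> \<in> trace_ideal R M"
  unfolding trace_ideal_def by (auto intro!: exI[of _ "{}"])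

lemma dual_zero: "\<alpha> \<in> carrier (dual_mod R M) \<Longrightarrow> \<alpha> \<zero>\<^bsub>M\<^esub> = \<zero>"
  using dualD(4)[of \<alpha> \<zero> "\<zero>\<^bsub>M\<^esub>"] dualD(1)[of \<alpha> "\<zero>\<^bsub>M\<^esub>"] by simp

text \<open>In the definition each functional contributes at most one term, so two sums cannot
  simply be concatenated. Both are padded to the union of their index sets, and the two terms of a
  common \<alpha> merge through \<alpha> x + \<alpha> y = \<alpha> (x + y).\<close>

lemma trace_ideal_add:
  assumes "r \<in> trace_ideal R M" "s \<in> trace_ideal R M"
  shows "r \<oplus> s \<in> trace_ideal R M"
proof -
  obtain c F where c: "r = finsum R c F" "finite F" "F \<subseteq> carrier (dual_mod R M)"
      "\<forall>\<alpha>\<in>F. c \<alpha> \<in> \<alpha> ` carrier M"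
    using assms(1) unfolding trace_ideal_def by auto
  obtain d G where d: "s = finsum R d G" "finite G" "G \<subseteq> carrier (dual_mod R M)"
      "\<forall>\<alpha>\<in>G. d \<alpha> \<in> \<alpha> ` carrier M"
    using assms(2) unfolding trace_ideal_def by auto
  define c' where "c' = (\<lambda>\<alpha>. if \<alpha> \<in> F then c \<alpha> else \<zero>)"
  define d' where "d' = (\<lambda>\<alpha>. if \<alpha> \<in> G then d \<alpha> else \<zero>)"
  have c': "c' \<alpha> \<in> \<alpha> ` carrier M" and d': "d' \<alpha> \<in> \<alpha> ` carrier M" if "\<alpha> \<in> F \<union> G" for \<alpha>
  proof -
    \<comment> \<open>Padding with zero is legitimate because zero is the value of every functional
      at zero.\<close>
    have "\<zero> \<in> \<alpha> ` carrier M"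
      using that c(3) d(3) dual_zero by (intro image_eqI[of _ _ "\<zero>\<^bsub>M\<^esub>"]) auto
    then show "c' \<alpha> \<in> \<alpha> ` carrier M" "d' \<alpha> \<in> \<alpha> ` carrier M"
      using c(4) d(4) by (auto simp: c'_def d'_def)
  qed
  have cl: "c' \<in> F \<union> G \<rightarrow> carrier R" "d' \<in> F \<union> G \<rightarrow> carrier R"
    using c' d' c(3) d(3) dual_image_closed[of _ "F \<union> G" c'] dual_image_closed[of _ "F \<union> G" d']
    by (simp_all add: Pi_iff)
  have "r = finsum R c' (F \<union> G)" unfolding c(1)
    by (rule R.add.finprod_mono_neutral_cong_left) (use c(2) d(2) cl in \<open>auto simp: c'_def\<close>)
  moreover have "s = finsum R d' (F \<union> G)" unfolding d(1)
    by (rule R.add.finprod_mono_neutral_cong_left) (use c(2) d(2) cl in \<open>auto simp: d'_def\<close>)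
  ultimately have "r \<oplus> s = finsum R (\<lambda>\<alpha>. c' \<alpha> \<oplus> d' \<alpha>) (F \<union> G)"
    using R.finsum_addf[OF cl] by simp
  moreover have "c' \<alpha> \<oplus> d' \<alpha> \<in> \<alpha> ` carrier M" if A: "\<alpha> \<in> F \<union> G" for \<alpha>
  proof -
    obtain x y where "c' \<alpha> = \<alpha> x" "d' \<alpha> = \<alpha> y" "x \<in> carrier M" "y \<in> carrier M"
      using c'[OF A] d'[OF A] by blast
    moreover have "\<alpha> \<in> carrier (dual_mod R M)" using A c(3) d(3) by blast
    ultimately show ?thesis by (intro image_eqI[of _ _ "x \<oplus>\<^bsub>M\<^esub> y"]) (auto simp: dualD(3))
  qed
  ultimately show ?thesis
    unfolding trace_ideal_def using c(2,3) d(2,3)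
    by (intro CollectI exI[of _ "\<lambda>\<alpha>. c' \<alpha> \<oplus> d' \<alpha>"] exI[of _ "F \<union> G"]) auto
qed

text \<open>Peels off one value of a functional at a time. The rest \<open>s\<close> is kept in the
  trace ideal, so that additivity of a map defined there can be applied in the inductive
  step.\<close>

lemma trace_ideal_induct [consumes 1, case_names zero add]:
  assumes r: "r \<in> trace_ideal R M"
    and zero: "P \<zero>"
    and add: "\<And>\<alpha> x s. \<lbrakk>\<alpha> \<in> carrier (dual_mod R M); x \<in> carrier M; s \<in> trace_ideal R M; P s\<rbrakk> \<Longrightarrow> P (\<alpha> x \<oplus> s)"
  shows "P r"
proof -
  have "P (finsum R c F)"
    if "finite F" "F \<subseteq> carrier (dual_mod R M)" "\<forall>\<alpha>\<in>F. c \<alpha> \<in> \<alpha> ` carrier M" for c F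
    using that
  proof (induction F rule: finite_induct)
    case empty
    then show ?case using zero by simp
  next
    case (insert \<alpha> F)
    then obtain x where x: "x \<in> carrier M" "c \<alpha> = \<alpha> x" by auto
    have "finsum R c F \<in> trace_ideal R M" unfolding trace_ideal_def using insert by blast
    moreover have "finsum R c (insert \<alpha> F) = \<alpha> x \<oplus> finsum R c F"
      unfolding x(2)[symmetric] using insert dual_image_closed[of _ "insert \<alpha> F" c]
      by (intro R.finsum_insert) auto
    ultimately show ?case using insert x add by auto
  qed
  then show ?thesis using r unfolding trace_ideal_def by auto
qed

lemma trace_ideal_smult:
  assumes "s \<in> trace_ideal R M" and r: "r \<in> carrier R"
  shows "r \<otimes> s \<in> trace_ideal R M"
  using assms(1)
proof (induction rule: trace_ideal_induct)
  case zero
  then show ?case using r trace_ideal_zero by simp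
next
  case (add \<alpha> x s)
  \<comment> \<open>The scalar is absorbed into the argument of the functional.\<close>
  have "r \<otimes> (\<alpha> x \<oplus> s) = \<alpha> (r \<odot>\<^bsub>M\<^esub> x) \<oplus> r \<otimes> s"
    using add r trace_ideal_subset dualD(1,4) by (auto simp: R.r_distr)
  then show ?case using add r by (simp add: trace_ideal_add trace_ideal_gen)
qed

lemma trace_mod_module: "Module.module R (trace_mod R M)"
proof -
  interpret A: Module.module R "regular_mod R" by (rule regular_mod_module)
  have "submodule (trace_ideal R M) R (regular_mod R)"
  proof (rule A.submoduleI)
    fix a assume a: "a \<in> trace_ideal R M"
    \<comment> \<open>Negation is multiplication by minus one, so closure under multiples
      suffices.\<close>
    then have "\<ominus>\<^bsub>regular_mod R\<^esub> a = (\<ominus> \<one>) \<otimes> a"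
      using A.smult_l_minus[of \<one> a] trace_ideal_subset by auto
    then show "\<ominus>\<^bsub>regular_mod R\<^esub> a \<in> trace_ideal R M" using trace_ideal_smult[OF a] by simp
  qed (simp_all add: trace_ideal_subset trace_ideal_zero trace_ideal_add trace_ideal_smult)
  then show ?thesis
    unfolding trace_mod_def by (rule submodule.submodule_is_module[OF _ regular_mod_module])
qed

section \<open>Characterisation of \<open>\<sigma>\<close>\<close>

lemma bilinear_pairing:
  assumes "f \<in> lin_maps R M M"
  shows "bilinear R M (dual_mod R M) (regular_mod R) (\<lambda>m \<alpha>. \<alpha> (f m))"
  unfolding bilinear_def by (simp add: lin_mapsD[OF assms] dualD, simp add: dual_mod_simps lin_mapsD[OF assms])

lemma theta:
  assumes "f \<in> lin_maps R M M"
  shows theta_lin: "theta R M f \<in> lin_maps R (tensor_mod R M (dual_mod R M)) (regular_mod R)"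
    and theta_pure: "\<And>m \<alpha>. m \<in> carrier M \<Longrightarrow> \<alpha> \<in> carrier (dual_mod R M) \<Longrightarrow>
      theta R M f (pure_tensor R M (dual_mod R M) m \<alpha>) = \<alpha> (f m)"
  unfolding theta_def
  using tensor_lift[OF module_axioms dual_mod_module regular_mod_module bilinear_pairing[OF assms]]
  by simp_all

text \<open>The definition lifts the pairing into \<open>R\<close>. Lifting it into the trace ideal
  instead gives a map that is also linear into \<open>R\<close>, and uniqueness identifies the two;
  hence the trace map lands in the trace ideal.\<close>

lemma trace_map:
  shows trace_map_lin: "trace_map R M \<in> lin_maps R (tensor_mod R M (dual_mod R M)) (trace_mod R M)"
    and trace_map_pure: "\<And>m \<alpha>. m \<in> carrier M \<Longrightarrow> \<alpha> \<in> carrier (dual_mod R M) \<Longrightarrow>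
      trace_map R M (pure_tensor R M (dual_mod R M) m \<alpha>) = \<alpha> m"
proof -
  let ?b = "\<lambda>m (\<alpha> :: 'c \<Rightarrow> 'a). \<alpha> m"
  let ?g = "tensor_lift R M (dual_mod R M) (trace_mod R M) ?b"
  have T: "bilinear R M (dual_mod R M) (trace_mod R M) ?b"
    unfolding bilinear_def by (simp add: dualD trace_ideal_gen, simp add: dual_mod_simps)
  have A: "bilinear R M (dual_mod R M) (regular_mod R) ?b"
    unfolding bilinear_def by (simp add: dualD, simp add: dual_mod_simps)
  note g = tensor_lift[OF module_axioms dual_mod_module trace_mod_module T]
  have gA: "?g \<in> lin_maps R (tensor_mod R M (dual_mod R M)) (regular_mod R)"
    using g(1) trace_ideal_subset by (auto simp: lin_maps_def PiE_iff)
  have "trace_map R M = ?g"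
    unfolding trace_map_def
    by (rule tensor_lift_eqI[OF module_axioms dual_mod_module regular_mod_module A gA g(2)])
  with g show "trace_map R M \<in> lin_maps R (tensor_mod R M (dual_mod R M)) (trace_mod R M)"
    and "\<And>m \<alpha>. m \<in> carrier M \<Longrightarrow> \<alpha> \<in> carrier (dual_mod R M) \<Longrightarrow>
      trace_map R M (pure_tensor R M (dual_mod R M) m \<alpha>) = \<alpha> m"
    by simp_all
qed

text \<open>Both sides are linear, and on the pure tensor of m and \<alpha> they take the values h
  (\<alpha> m) and \<alpha> (f m).\<close>

lemma trace_pullback_eq_theta:
  assumes f: "f \<in> lin_maps R M M" and h: "h \<in> lin_maps R (trace_mod R M) (trace_mod R M)"
    and fh: "\<And>m \<alpha>. m \<in> carrier M \<Longrightarrow> \<alpha> \<in> carrier (dual_mod R M) \<Longrightarrow> \<alpha> (f m) = h (\<alpha> m)"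
  shows "trace_pullback R M h = theta R M f"
proof -
  have "trace_pullback R M h \<in> lin_maps R (tensor_mod R M (dual_mod R M)) (regular_mod R)"
    using lin_mapsD[OF trace_map_lin] lin_mapsD[OF h] trace_ideal_subset
      tensor_mod_closed[OF module_axioms dual_mod_module]
    by (intro lin_mapsI) (auto simp: trace_pullback_def compose_def)
  then show ?thesis
    unfolding theta_def
    by (intro tensor_lift_eqI[OF module_axioms dual_mod_module regular_mod_module bilinear_pairing[OF f], symmetric])
      (auto simp: trace_pullback_def compose_def pure_tensor_closed trace_map_pure fh)
qed

section \<open>Reflexivity and the characterising equation\<close>

lemma reflexive_separating:
  assumes "reflexive_mod R M" "x \<in> carrier M" "y \<in> carrier M"
    and "\<And>\<alpha>. \<alpha> \<in> carrier (dual_mod R M) \<Longrightarrow> \<alpha> x = \<alpha> y"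
  shows "x = y"
proof (rule inj_onD)
  show "inj_on (eval_map R M) (carrier M)"
    using assms(1) by (auto simp: reflexive_mod_def mod_iso_def bij_betw_def)
  show "eval_map R M x = eval_map R M y"
    using assms by (auto simp: eval_map_def)
qed (use assms in auto)

text \<open>Surjectivity of \<open>eval_map\<close>, the source of the values of
  \<open>sigma R M h\<close>; its injectivity, used just before, gives their uniqueness.\<close>

lemma reflexive_realizes:
  assumes "reflexive_mod R M" "\<phi> \<in> carrier (dual_mod R (dual_mod R M))"
  shows "\<exists>x\<in>carrier M. \<forall>\<alpha>\<in>carrier (dual_mod R M). \<phi> \<alpha> = \<alpha> x"
proof -
  have "eval_map R M ` carrier M = carrier (dual_mod R (dual_mod R M))"
    using assms(1) by (auto simp: reflexive_mod_def mod_iso_def bij_betw_def)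
  then obtain x where "x \<in> carrier M" "\<phi> = eval_map R M x" using assms(2) by blast
  then show ?thesis by (auto simp: eval_map_def)
qed

text \<open>Evaluation on pure tensors recovers \<alpha> (f x) from \<open>theta R M f\<close>, and
  functionals separate points. This lets \<open>inv_into\<close> be computed.\<close>

lemma theta_inj:
  assumes "reflexive_mod R M"
  shows "inj_on (theta R M) (lin_maps R M M)"
proof (rule inj_onI)
  fix f g assume f: "f \<in> lin_maps R M M" and g: "g \<in> lin_maps R M M" and eq: "theta R M f = theta R M g"
  show "f = g"
  proof (rule lin_maps_eqI[OF f g])
    fix x assume x: "x \<in> carrier M"
    show "f x = g x"
    proof (rule reflexive_separating[OF assms])
      fix \<alpha> assume "\<alpha> \<in> carrier (dual_mod R M)"
      from theta_pure[OF f x this] theta_pure[OF g x this] show "\<alpha> (f x) = \<alpha> (g x)"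
        unfolding eq by simp
    qed (simp_all add: x lin_mapsD(1)[OF f] lin_mapsD(1)[OF g])
  qed
qed

text \<open>The characterising equation determines \<open>sigma R M h\<close>. From here on, values
  of \<open>sigma\<close> are computed through this rule instead of its definition by
  \<open>inv_into\<close>.\<close>

lemma sigma_eqI:
  assumes "reflexive_mod R M" "f \<in> lin_maps R M M" "h \<in> lin_maps R (trace_mod R M) (trace_mod R M)"
    and "\<And>m \<alpha>. m \<in> carrier M \<Longrightarrow> \<alpha> \<in> carrier (dual_mod R M) \<Longrightarrow> \<alpha> (f m) = h (\<alpha> m)"
  shows "sigma R M h = f"
proof -
  have "trace_pullback R M h = theta R M f"
    by (rule trace_pullback_eq_theta[OF assms(2,3)]) (fact assms(4))
  then show ?thesis
    using inv_into_f_f[OF theta_inj[OF assms(1)] assms(2)] by (simp add: sigma_def End_alg_simps)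
qed

text \<open>For fixed m, the map sending \<alpha> to h (\<alpha> m) lies in the double dual, hence
  is evaluation at some element of M; that element is the value at m.\<close>

lemma sigma:
  assumes refl: "reflexive_mod R M" and h: "h \<in> lin_maps R (trace_mod R M) (trace_mod R M)"
  shows sigma_lin: "sigma R M h \<in> lin_maps R M M"
    and dual_sigma: "\<And>m \<alpha>. m \<in> carrier M \<Longrightarrow> \<alpha> \<in> carrier (dual_mod R M) \<Longrightarrow> \<alpha> (sigma R M h m) = h (\<alpha> m)"
proof -
  have hD: "\<And>r. r \<in> trace_ideal R M \<Longrightarrow> h r \<in> trace_ideal R M"
    "\<And>r s. r \<in> trace_ideal R M \<Longrightarrow> s \<in> trace_ideal R M \<Longrightarrow> h (r \<oplus> s) = h r \<oplus> h s"
    "\<And>r s. r \<in> carrier R \<Longrightarrow> s \<in> trace_ideal R M \<Longrightarrow> h (r \<otimes> s) = r \<otimes> h s"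
    using lin_mapsD[OF h] by auto
  note cl = subsetD[OF trace_ideal_subset]
  interpret D: Module.module R "dual_mod R M" by (rule dual_mod_module)
  have "\<exists>y\<in>carrier M. \<forall>\<alpha>\<in>carrier (dual_mod R M). h (\<alpha> m) = \<alpha> y" if m: "m \<in> carrier M" for m
  proof -
    have "(\<lambda>\<alpha>\<in>carrier (dual_mod R M). h (\<alpha> m)) \<in> carrier (dual_mod R (dual_mod R M))"
      unfolding dual_mod_simps(1)[of R "dual_mod R M"]
    proof (rule lin_mapsI)
      fix \<alpha> \<beta> assume ab: "\<alpha> \<in> carrier (dual_mod R M)" "\<beta> \<in> carrier (dual_mod R M)"
      have "(\<alpha> \<oplus>\<^bsub>dual_mod R M\<^esub> \<beta>) m = \<alpha> m \<oplus> \<beta> m" using m by (simp add: dual_mod_simps)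
      with ab m show "(\<lambda>\<alpha>\<in>carrier (dual_mod R M). h (\<alpha> m)) (\<alpha> \<oplus>\<^bsub>dual_mod R M\<^esub> \<beta>) =
        (\<lambda>\<alpha>\<in>carrier (dual_mod R M). h (\<alpha> m)) \<alpha> \<oplus>\<^bsub>regular_mod R\<^esub> (\<lambda>\<alpha>\<in>carrier (dual_mod R M). h (\<alpha> m)) \<beta>"
        by (simp add: hD trace_ideal_gen)
    next
      fix r \<alpha> assume ra: "r \<in> carrier R" "\<alpha> \<in> carrier (dual_mod R M)"
      have "(r \<odot>\<^bsub>dual_mod R M\<^esub> \<alpha>) m = r \<otimes> \<alpha> m" using m by (simp add: dual_mod_simps)
      with ra m show "(\<lambda>\<alpha>\<in>carrier (dual_mod R M). h (\<alpha> m)) (r \<odot>\<^bsub>dual_mod R M\<^esub> \<alpha>) =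
        r \<odot>\<^bsub>regular_mod R\<^esub> (\<lambda>\<alpha>\<in>carrier (dual_mod R M). h (\<alpha> m)) \<alpha>"
        by (simp add: hD trace_ideal_gen)
    qed (simp_all add: m cl hD trace_ideal_gen)
    from reflexive_realizes[OF refl this] show ?thesis by simp
  qed
  then obtain f0 where f0: "\<And>m. m \<in> carrier M \<Longrightarrow> f0 m \<in> carrier M"
    "\<And>m \<alpha>. m \<in> carrier M \<Longrightarrow> \<alpha> \<in> carrier (dual_mod R M) \<Longrightarrow> \<alpha> (f0 m) = h (\<alpha> m)" by metis
  define f where "f = (\<lambda>m\<in>carrier M. f0 m)"
  have fc: "f m \<in> carrier M" if "m \<in> carrier M" for m using that f0 by (simp add: f_def)
  have fh: "\<alpha> (f m) = h (\<alpha> m)" if "m \<in> carrier M" "\<alpha> \<in> carrier (dual_mod R M)" for m \<alpha>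
    using that f0 by (simp add: f_def)
  \<comment> \<open>The values were chosen separately for each m. Linearity holds since both sides
    of each law agree under every functional.\<close>
  have f: "f \<in> lin_maps R M M"
  proof (rule lin_mapsI)
    fix x y assume xy: "x \<in> carrier M" "y \<in> carrier M"
    show "f (x \<oplus>\<^bsub>M\<^esub> y) = f x \<oplus>\<^bsub>M\<^esub> f y"
      by (rule reflexive_separating[OF refl]) (simp_all add: xy fc fh hD dualD trace_ideal_gen)
  next
    fix r x assume rx: "r \<in> carrier R" "x \<in> carrier M"
    show "f (r \<odot>\<^bsub>M\<^esub> x) = r \<odot>\<^bsub>M\<^esub> f x"
      by (rule reflexive_separating[OF refl]) (simp_all add: rx fc fh hD dualD trace_ideal_gen)
  qed (use fc in \<open>simp_all add: f_def\<close>)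
  have "sigma R M h = f" by (rule sigma_eqI[OF refl f h fh])
  with f fh show "sigma R M h \<in> lin_maps R M M"
    and "\<And>m \<alpha>. m \<in> carrier M \<Longrightarrow> \<alpha> \<in> carrier (dual_mod R M) \<Longrightarrow> \<alpha> (sigma R M h m) = h (\<alpha> m)"
    by simp_all
qed

section \<open>Centrality and injectivity\<close>

lemma sigma_central:
  assumes refl: "reflexive_mod R M" and h: "h \<in> lin_maps R (trace_mod R M) (trace_mod R M)"
  shows "sigma R M h \<in> carrier (center_alg (End_alg R M))"
proof -
  note s = sigma[OF assms]
  have "compose (carrier M) (sigma R M h) g = compose (carrier M) g (sigma R M h)"
    if g: "g \<in> lin_maps R M M" for g
  proof (rule lin_maps_eqI[OF lin_maps_compose[OF s(1) g] lin_maps_compose[OF g s(1)]])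
    fix m assume m: "m \<in> carrier M"
    note cl = lin_mapsD(1)[OF s(1)] lin_mapsD(1)[OF g]
    have "sigma R M h (g m) = g (sigma R M h m)"
    proof (rule reflexive_separating[OF refl])
      fix \<alpha> assume a: "\<alpha> \<in> carrier (dual_mod R M)"
      \<comment> \<open>The characterising equation is used twice: for \<alpha> composed with g at
        m, and for \<alpha> at g m. Both give h (\<alpha> (g m)).\<close>
      have ag: "compose (carrier M) \<alpha> g \<in> carrier (dual_mod R M)"
        using lin_maps_compose[OF _ g] a by (simp add: dual_mod_simps)
      have "\<alpha> (g (sigma R M h m)) = compose (carrier M) \<alpha> g (sigma R M h m)"
        using m cl by (simp add: compose_def)
      also have "\<dots> = h (\<alpha> (g m))" using s(2)[OF m ag] m by (simp add: compose_def)
      finally show "\<alpha> (sigma R M h (g m)) = \<alpha> (g (sigma R M h m))" using m a cl s(2) by simp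
    qed (use m cl in auto)
    then show "compose (carrier M) (sigma R M h) g m = compose (carrier M) g (sigma R M h) m"
      using m by (simp add: compose_def)
  qed
  then show ?thesis using s(1) by (simp add: center_alg_simps End_alg_simps)
qed

lemma sigma_inj:
  assumes refl: "reflexive_mod R M"
  shows "inj_on (sigma R M) (lin_maps R (trace_mod R M) (trace_mod R M))"
proof (rule inj_onI)
  fix h k assume h: "h \<in> lin_maps R (trace_mod R M) (trace_mod R M)"
    and k: "k \<in> lin_maps R (trace_mod R M) (trace_mod R M)" and eq: "sigma R M h = sigma R M k"
  have gen: "h (\<alpha> x) = k (\<alpha> x)" if "\<alpha> \<in> carrier (dual_mod R M)" "x \<in> carrier M" for \<alpha> x
    using that dual_sigma[OF refl h] dual_sigma[OF refl k] eq by metis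
  show "h = k"
  proof (rule lin_maps_eqI[OF h k])
    fix r assume "r \<in> carrier (trace_mod R M)"
    then have "r \<in> trace_ideal R M" by simp
    then show "h r = k r"
    proof (induction rule: trace_ideal_induct)
      case zero
      \<comment> \<open>Homogeneity with scalar zero shows that both maps vanish at zero.\<close>
      have "\<zero> \<in> trace_ideal R M" "h \<zero> \<in> carrier R" "k \<zero> \<in> carrier R"
        using trace_ideal_zero trace_ideal_subset lin_mapsD(1)[OF h, of \<zero>] lin_mapsD(1)[OF k, of \<zero>] by auto
      then show ?case
        using lin_mapsD(4)[OF h, of \<zero> \<zero>] lin_mapsD(4)[OF k, of \<zero> \<zero>] by simp
    next
      case (add \<alpha> x s)
      then show ?case
        using lin_mapsD(3)[OF h, of "\<alpha> x" s] lin_mapsD(3)[OF k, of "\<alpha> x" s] gen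
        by (simp add: trace_ideal_gen)
    qed
  qed
qed

section \<open>Surjectivity onto the center\<close>

lemma central_dual_swap:
  assumes f: "f \<in> carrier (center_alg (End_alg R M))"
    and a: "\<alpha> \<in> carrier (dual_mod R M)" and x: "x \<in> carrier M" and m: "m \<in> carrier M"
  shows "\<alpha> (f x) \<odot>\<^bsub>M\<^esub> m = \<alpha> x \<odot>\<^bsub>M\<^esub> f m"
proof -
  \<comment> \<open>An endomorphism with image in the multiples of m; commuting it with f at x is
    the claim.\<close>
  let ?g = "\<lambda>y\<in>carrier M. \<alpha> y \<odot>\<^bsub>M\<^esub> m"
  have fl: "f \<in> lin_maps R M M" using f by (simp add: center_alg_simps End_alg_simps)
  have "?g \<in> lin_maps R M M"
    by (rule lin_mapsI) (simp_all add: m a dualD smult_l_distr smult_assoc1)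
  then have "compose (carrier M) f ?g = compose (carrier M) ?g f"
    using f by (simp add: center_alg_simps End_alg_simps)
  from fun_cong[OF this, of x] show ?thesis
    using x lin_mapsD[OF fl] m dualD(1)[OF a x] by (simp add: compose_def)
qed

text \<open>Faithfulness applied to the difference. It turns equal actions on M into equality in
  \<open>R\<close>, which makes \<open>h\<close> in \<open>sigma_surj\<close> linear.\<close>

lemma faithful_cancel:
  assumes "faithful_mod R M" "r \<in> carrier R" "s \<in> carrier R"
    and "\<And>m. m \<in> carrier M \<Longrightarrow> r \<odot>\<^bsub>M\<^esub> m = s \<odot>\<^bsub>M\<^esub> m"
  shows "r = s"
proof -
  have "(r \<ominus> s) \<odot>\<^bsub>M\<^esub> m = \<zero>\<^bsub>M\<^esub>" if "m \<in> carrier M" for m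
    using that assms by (simp add: R.minus_eq smult_l_distr smult_l_minus M.r_neg)
  then have "r \<ominus> s = \<zero>" using assms unfolding faithful_mod_def by simp
  then show ?thesis using assms by simp
qed

lemma sigma_surj:
  assumes refl: "reflexive_mod R M" and faith: "faithful_mod R M"
    and f: "f \<in> carrier (center_alg (End_alg R M))"
  shows "\<exists>h\<in>lin_maps R (trace_mod R M) (trace_mod R M). sigma R M h = f"
proof -
  have fl: "f \<in> lin_maps R M M" using f by (simp add: center_alg_simps End_alg_simps)
  note fc = lin_mapsD(1)[OF fl]
  note cl = subsetD[OF trace_ideal_subset]
  have "\<exists>s\<in>trace_ideal R M. \<forall>m\<in>carrier M. s \<odot>\<^bsub>M\<^esub> m = r \<odot>\<^bsub>M\<^esub> f m" if "r \<in> trace_ideal R M" for r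
    using that
  proof (induction rule: trace_ideal_induct)
    case zero
    show ?case using trace_ideal_zero fc by (intro bexI[of _ \<zero>]) simp_all
  next
    case (add \<alpha> x r)
    then obtain s where s: "s \<in> trace_ideal R M" "\<forall>m\<in>carrier M. s \<odot>\<^bsub>M\<^esub> m = r \<odot>\<^bsub>M\<^esub> f m" by blast
    have "(\<alpha> (f x) \<oplus> s) \<odot>\<^bsub>M\<^esub> m = (\<alpha> x \<oplus> r) \<odot>\<^bsub>M\<^esub> f m" if "m \<in> carrier M" for m
      \<comment> \<open>The new generator \<alpha> x contributes \<alpha> (f x), by
        \<open>central_dual_swap\<close>.\<close>
      using that s add fc cl central_dual_swap[OF f] by (simp add: smult_l_distr dualD(1))
    then show ?case
      using s(1) add fc by (intro bexI[of _ "\<alpha> (f x) \<oplus> s"]) (auto simp: trace_ideal_add trace_ideal_gen)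
  qed
  then obtain h0 where h0: "\<And>r. r \<in> trace_ideal R M \<Longrightarrow> h0 r \<in> trace_ideal R M"
    "\<And>r m. r \<in> trace_ideal R M \<Longrightarrow> m \<in> carrier M \<Longrightarrow> h0 r \<odot>\<^bsub>M\<^esub> m = r \<odot>\<^bsub>M\<^esub> f m" by metis
  define h where "h = (\<lambda>r\<in>trace_ideal R M. h0 r)"
  have hc: "h r \<in> trace_ideal R M" if "r \<in> trace_ideal R M" for r
    using that h0 by (simp add: h_def)
  have hf: "h r \<odot>\<^bsub>M\<^esub> m = r \<odot>\<^bsub>M\<^esub> f m" if "r \<in> trace_ideal R M" "m \<in> carrier M" for r m
    using that h0 by (simp add: h_def)
  have h: "h \<in> lin_maps R (trace_mod R M) (trace_mod R M)"
  proof (rule lin_mapsI)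
    fix r s assume "r \<in> carrier (trace_mod R M)" "s \<in> carrier (trace_mod R M)"
    then have "h (r \<oplus> s) = h r \<oplus> h s"
      by (intro faithful_cancel[OF faith]) (simp_all add: hc hf cl fc trace_ideal_add smult_l_distr)
    then show "h (r \<oplus>\<^bsub>trace_mod R M\<^esub> s) = h r \<oplus>\<^bsub>trace_mod R M\<^esub> h s" by simp
  next
    fix r s assume "r \<in> carrier R" "s \<in> carrier (trace_mod R M)"
    then have "h (r \<otimes> s) = r \<otimes> h s"
      by (intro faithful_cancel[OF faith]) (simp_all add: hc hf cl fc trace_ideal_smult smult_assoc1)
    then show "h (r \<odot>\<^bsub>trace_mod R M\<^esub> s) = r \<odot>\<^bsub>trace_mod R M\<^esub> h s" by simp
  qed (use hc in \<open>simp_all add: h_def\<close>)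
  \<comment> \<open>Both ring elements send y in M to \<alpha> m times f y: one by
    \<open>central_dual_swap\<close>, the other by the choice of \<open>h\<close>.\<close>
  have "\<alpha> (f m) = h (\<alpha> m)" if "m \<in> carrier M" "\<alpha> \<in> carrier (dual_mod R M)" for m \<alpha>
    by (rule faithful_cancel[OF faith])
      (simp_all add: that hc hf cl fc trace_ideal_gen central_dual_swap[OF f])
  then have "sigma R M h = f" by (rule sigma_eqI[OF refl fl h])
  with h show ?thesis by blast
qed

text \<open>Each algebra law follows from \<open>sigma_eqI\<close>, the right-hand side being
  checked against the characterising equation. For products, \<alpha> (sigma h (sigma k m)) = h
  (\<alpha> (sigma k m)) = h (k (\<alpha> m)), so the order of composition is preserved.\<close>

lemma sigma_alg_iso:
  assumes refl: "reflexive_mod R M" and faith: "faithful_mod R M"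
  shows "sigma R M \<in> alg_iso R (End_alg R (trace_mod R M)) (center_alg (End_alg R M))"
proof -
  interpret T: Module.module R "trace_mod R M" by (rule trace_mod_module)
  note s = sigma[OF refl]
  note sc = lin_mapsD(1)[OF s(1)]
  let ?E = "lin_maps R (trace_mod R M) (trace_mod R M)"
  have mult: "sigma R M (compose (trace_ideal R M) h k) = compose (carrier M) (sigma R M h) (sigma R M k)"
    if h: "h \<in> ?E" and k: "k \<in> ?E" for h k
    using T.lin_maps_compose[OF h k] lin_maps_compose[OF s(1)[OF h] s(1)[OF k]]
    by (intro sigma_eqI[OF refl]) (simp_all add: compose_def h k s sc trace_ideal_gen)
  have add: "sigma R M (\<lambda>r\<in>trace_ideal R M. h r \<oplus> k r) = (\<lambda>m\<in>carrier M. sigma R M h m \<oplus>\<^bsub>M\<^esub> sigma R M k m)"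
    if h: "h \<in> ?E" and k: "k \<in> ?E" for h k
  proof (rule sigma_eqI[OF refl])
    show "(\<lambda>m\<in>carrier M. sigma R M h m \<oplus>\<^bsub>M\<^esub> sigma R M k m) \<in> lin_maps R M M"
      by (rule lin_maps_add[OF module_axioms module_axioms s(1)[OF h] s(1)[OF k]])
    show "(\<lambda>r\<in>trace_ideal R M. h r \<oplus> k r) \<in> ?E"
      using lin_maps_add[OF T.module_axioms T.module_axioms h k] by simp
  qed (simp add: h k s sc dualD trace_ideal_gen)
  have smult: "sigma R M (\<lambda>s\<in>trace_ideal R M. r \<otimes> h s) = (\<lambda>m\<in>carrier M. r \<odot>\<^bsub>M\<^esub> sigma R M h m)"
    if h: "h \<in> ?E" and r: "r \<in> carrier R" for h r
  proof (rule sigma_eqI[OF refl])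
    show "(\<lambda>m\<in>carrier M. r \<odot>\<^bsub>M\<^esub> sigma R M h m) \<in> lin_maps R M M"
      by (rule lin_maps_smult[OF module_axioms module_axioms s(1)[OF h] r])
    show "(\<lambda>s\<in>trace_ideal R M. r \<otimes> h s) \<in> ?E"
      using lin_maps_smult[OF T.module_axioms T.module_axioms h r] by simp
  qed (simp add: h r s sc dualD trace_ideal_gen)
  have one: "sigma R M (\<lambda>r\<in>trace_ideal R M. r) = (\<lambda>m\<in>carrier M. m)"
    by (intro sigma_eqI[OF refl] lin_mapsI)
      (simp_all add: trace_ideal_gen trace_ideal_add trace_ideal_smult)
  have "sigma R M \<in> ring_hom (End_alg R (trace_mod R M)) (center_alg (End_alg R M))"
    by (rule ring_hom_memI)
      \<comment> \<open>The carrier equation of \<open>center_alg_simps\<close> is left out so that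
        membership in the center keeps the form of \<open>sigma_central\<close>.\<close>
      (simp_all add: center_alg_simps(2-) End_alg_simps sigma_central[OF refl] mult add one)
  moreover have "bij_betw (sigma R M) ?E (carrier (center_alg (End_alg R M)))"
    unfolding bij_betw_def
    using sigma_inj[OF refl] sigma_central[OF refl] sigma_surj[OF refl faith] by blast
  ultimately show ?thesis
    by (simp add: alg_iso_def ring_iso_def End_alg_simps center_alg_simps(3) smult)
qed

end

theorem theorem3p9:
  fixes R :: "('a, 'k) ring_scheme" and M :: "('a, 'b, 'm) module_scheme"
  assumes "noetherian_ring R"
    and "module R M"
    and "fin_gen_mod R M"
    and "faithful_mod R M"
    and "reflexive_mod R M"
  shows "sigma R M \<in> carrier (End_alg R (trace_mod R M)) \<rightarrow> carrier (center_alg (End_alg R M)) \<and>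
    sigma R M \<in> alg_iso R (End_alg R (trace_mod R M)) (center_alg (End_alg R M))"
proof -
  interpret Module.module R M by (rule assms(2))
  show ?thesis
    using sigma_central sigma_alg_iso assms(4,5) by (auto simp: End_alg_simps(1))
qed

end
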